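(* Let $\mathcal{M}$ be a von Neumann algebra, let $\preceq$ be the star order on $\mathcal{M}$, and let $\mathcal{M}_{inv}$ be the set of all invertible elements in $\mathcal{M}$. If $\mathcal{M}$ is infinite-dimensional, then the set $\mathcal{M}\setminus\mathcal{M}_{inv}$ of all noninvertible elements in $\mathcal{M}$ is not order closed in $(\mathcal{M},\preceq)$. In this case, the topology $\tau_o(\mathcal{M},\preceq)$ is not comparable with the norm topology $\tau_u(\mathcal{M})$, i.e. neither $\tau_o(\mathcal{M},\preceq)\subseteq\tau_u(\mathcal{M})$ nor $\tau_u(\mathcal{M})\subseteq\tau_o(\mathcal{M},\preceq)$.
   Context: A von Neumann algebra is a strongly closed C*-subalgebra of the C*-algebra $\mathscr{B}(\mathscr{H})$ of all bounded operators on a complex Hilbert space $\mathscr{H}$; invertibility is with respect to the unit $\mathbf{1}$ of $\mathcal{M}$. The star order on $\mathcal{M}$ is the partial order defined by $x\preceq y$ if and only if $x^*x=x^*y$ and $xx^*=yx^*$. $\tau_u(\mathcal{M})$ is the topology of the operator norm on $\mathcal{M}$. Order convergence and order topology: let $(P,\leq)$ be a poset. A net $(x_\alpha)_{\alpha\in\Gamma}$ in $P$ is order convergent to $x\in P$ in $(P,\leq)$ if there are nets $(y_\alpha)_{\alpha\in\Gamma}$ and $(z_\alpha)_{\alpha\in\Gamma}$ in $P$ (with the same index set) such that $y_\alpha\leq x_\alpha\leq z_\alpha$ for all $\alpha\in\Gamma$, $(y_\alpha)$ is increasing with supremum $x$ in $P$, and $(z_\alpha)$ is decreasing with infimum $x$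 in $P$. A subset $C\subseteq P$ is order closed if no net in $C$ is order convergent to a point of $P\setminus C$. The order topology $\tau_o(P,\leq)$ is the topology on $P$ whose closed sets are exactly the order closed sets. *)

theory Defs
  imports "HOL-Analysis.Analysis"
begin

section \<open>Complex Hilbert spaces\<close>

class complex_vector = real_vector +
  fixes scaleC :: "complex \<Rightarrow> 'a \<Rightarrow> 'a" (infixr "*\<^sub>C" 75)
  assumes scaleC_add_right: "c *\<^sub>C (x + y) = c *\<^sub>C x + c *\<^sub>C y"
    and scaleC_add_left: "(c + d) *\<^sub>C x = c *\<^sub>C x + d *\<^sub>C x"
    and scaleC_scaleC: "c *\<^sub>C d *\<^sub>C x = (c * d) *\<^sub>C x"
    and scaleR_scaleC: "r *\<^sub>R x = complex_of_real r *\<^sub>C x"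

lemma scaleC_one: "1 *\<^sub>C x = (x :: 'a :: complex_vector)"
  using scaleR_scaleC[of 1 x] by simp

global_interpretation complex_vector: vector_space "scaleC :: complex \<Rightarrow> 'a \<Rightarrow> 'a :: complex_vector"
  defines csubspace_raw_def: csubspace = complex_vector.subspace
    and cspan_raw_def: cspan = complex_vector.span
  by unfold_locales (simp_all add: scaleC_add_right scaleC_add_left scaleC_scaleC scaleC_one)

text \<open>The underlying real inner product is tied to the complex one by its real part, so the
  norm inherited from \<^class>\<open>real_inner\<close> is the Hilbert space norm and positive definiteness
  of \<open>cinner\<close> follows. The complex inner product is linear in its first argument.\<close>

class complex_inner = complex_vector + real_inner +
  fixes cinner :: "'a \<Rightarrow> 'a \<Rightarrow> complex"
  assumes cinner_commute: "cinner x y = cnj (cinner y x)"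
    and cinner_add_left: "cinner (x + y) z = cinner x z + cinner y z"
    and cinner_scaleC_left: "cinner (c *\<^sub>C x) y = c * cinner x y"
    and inner_eq_Re_cinner: "inner x y = Re (cinner x y)"

class chilbert_space = complex_inner + complete_space

lemma cinner_scaleC_right: "cinner x (c *\<^sub>C y) = cnj c * cinner x y"
  by (metis cinner_commute cinner_scaleC_left complex_cnj_mult complex_cnj_cnj)

lemma cinner_self: "cinner x x = complex_of_real ((norm x)\<^sup>2)"
proof -
  have "Im (cinner x x) = 0"
    using arg_cong[OF cinner_commute[of x x], of Im] by simp
  then show ?thesis
    by (simp add: complex_eq_iff power2_norm_eq_inner inner_eq_Re_cinner)
qed

lemma norm_scaleC: "norm (c *\<^sub>C x) = cmod c * norm (x :: 'a :: complex_inner)"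
proof -
  have "complex_of_real ((norm (c *\<^sub>C x))\<^sup>2) = (c * cnj c) * cinner x x"
    unfolding cinner_self[symmetric] by (simp add: cinner_scaleC_left cinner_scaleC_right)
  also have "\<dots> = complex_of_real ((cmod c * norm x)\<^sup>2)"
    by (simp add: cinner_self complex_norm_square[symmetric] power_mult_distrib)
  finally have "(norm (c *\<^sub>C x))\<^sup>2 = (cmod c * norm x)\<^sup>2"
    using of_real_eq_iff by blast
  then show ?thesis
    by (simp add: power2_eq_iff_nonneg)
qed

lemma bounded_linear_scaleC_right:
  "bounded_linear (\<lambda>x. c *\<^sub>C (x :: 'a :: complex_inner))"
proof (rule bounded_linear_intro[where K = "cmod c"])
  show "c *\<^sub>C (r *\<^sub>R x) = r *\<^sub>R (c *\<^sub>C x)" for r and x :: 'a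
    by (simp add: scaleR_scaleC scaleC_scaleC mult.commute)
qed (simp_all add: scaleC_add_right norm_scaleC mult.commute)


section \<open>Bounded operators\<close>

instantiation blinfun :: (real_normed_vector, complex_inner) complex_vector
begin

definition scaleC_blinfun :: "complex \<Rightarrow> ('a \<Rightarrow>\<^sub>L 'b) \<Rightarrow> 'a \<Rightarrow>\<^sub>L 'b"
  where "scaleC_blinfun c T = Blinfun (\<lambda>x. c *\<^sub>C blinfun_apply T x)"

lemma blinfun_apply_scaleC: "blinfun_apply (c *\<^sub>C T) x = c *\<^sub>C blinfun_apply T x"
  unfolding scaleC_blinfun_def
  by (subst bounded_linear_Blinfun_apply)
    (auto intro: bounded_linear_compose[OF bounded_linear_scaleC_right] blinfun.bounded_linear_right)

instance
  by standard
    (auto intro!: blinfun_eqI simp: blinfun_apply_scaleC blinfun.add_left blinfun.scaleR_left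
      scaleC_add_right scaleC_add_left scaleC_scaleC scaleR_scaleC[symmetric])

end

text \<open>The elements of the library's type of bounded operators are only real linear, so the algebra
  of bounded operators on the complex Hilbert space is carved out by complex homogeneity.\<close>

definition bounded_operators :: "('h :: chilbert_space \<Rightarrow>\<^sub>L 'h) set"
  where "bounded_operators = {T. \<forall>c x. blinfun_apply T (c *\<^sub>C x) = c *\<^sub>C blinfun_apply T x}"

text \<open>Only meaningful on \<open>bounded_operators\<close>, where the adjoint exists by the Riesz representation
  theorem and is unique.\<close>

definition adj :: "('h :: chilbert_space \<Rightarrow>\<^sub>L 'h) \<Rightarrow> 'h \<Rightarrow>\<^sub>L 'h"
  where "adj T = (THE S. \<forall>x y. cinner (blinfun_apply T x) y = cinner x (blinfun_apply S y))"


section \<open>Von Neumann algebras\<close>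

definition cstar_subalgebra :: "('h :: chilbert_space \<Rightarrow>\<^sub>L 'h) set \<Rightarrow> bool"
  where "cstar_subalgebra M \<longleftrightarrow>
    M \<subseteq> bounded_operators \<and> csubspace M \<and>
    (\<forall>S\<in>M. \<forall>T\<in>M. S o\<^sub>L T \<in> M) \<and> (\<forall>T\<in>M. adj T \<in> M) \<and> closed M"

text \<open>The unit of the algebra is not required to be the identity operator of the Hilbert space.\<close>

definition von_neumann_algebra :: "('h :: chilbert_space \<Rightarrow>\<^sub>L 'h) set \<Rightarrow> bool"
  where "von_neumann_algebra M \<longleftrightarrow>
    cstar_subalgebra M \<and> closedin (subtopology strong_operator_topology bounded_operators) M"

definition infinite_dimensional :: "'a :: complex_vector set \<Rightarrow> bool"
  where "infinite_dimensional V \<longleftrightarrow> \<not> (\<exists>B. finite B \<and> B \<subseteq> V \<and> cspan B = V)"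

definition is_unit_of :: "('h :: chilbert_space \<Rightarrow>\<^sub>L 'h) set \<Rightarrow> ('h \<Rightarrow>\<^sub>L 'h) \<Rightarrow> bool"
  where "is_unit_of M e \<longleftrightarrow> e \<in> M \<and> (\<forall>x\<in>M. e o\<^sub>L x = x \<and> x o\<^sub>L e = x)"

definition invertibles :: "('h :: chilbert_space \<Rightarrow>\<^sub>L 'h) set \<Rightarrow> ('h \<Rightarrow>\<^sub>L 'h) set"
  where "invertibles M = {x \<in> M. \<exists>e. is_unit_of M e \<and> (\<exists>y\<in>M. x o\<^sub>L y = e \<and> y o\<^sub>L x = e)}"

definition star_le :: "('h :: chilbert_space \<Rightarrow>\<^sub>L 'h) \<Rightarrow> ('h \<Rightarrow>\<^sub>L 'h) \<Rightarrow> bool"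
  where "star_le x y \<longleftrightarrow> adj x o\<^sub>L x = adj x o\<^sub>L y \<and> x o\<^sub>L adj x = y o\<^sub>L adj x"

abbreviation norm_topology :: "('h :: chilbert_space \<Rightarrow>\<^sub>L 'h) set \<Rightarrow> ('h \<Rightarrow>\<^sub>L 'h) topology"
  where "norm_topology M \<equiv> top_of_set M"


section \<open>Order convergence and the order topology of a poset\<close>

text \<open>A poset is given by a carrier \<open>P\<close> and a relation \<open>le\<close>, of which only the restriction
  to \<open>P\<close> matters.\<close>

definition is_supremum :: "'a set \<Rightarrow> ('a \<Rightarrow> 'a \<Rightarrow> bool) \<Rightarrow> 'a set \<Rightarrow> 'a \<Rightarrow> bool"
  where "is_supremum P le A s \<longleftrightarrow>
    s \<in> P \<and> (\<forall>a\<in>A. le a s) \<and> (\<forall>u\<in>P. (\<forall>a\<in>A. le a u) \<longrightarrow> le s u)"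

definition is_infimum :: "'a set \<Rightarrow> ('a \<Rightarrow> 'a \<Rightarrow> bool) \<Rightarrow> 'a set \<Rightarrow> 'a \<Rightarrow> bool"
  where "is_infimum P le A s \<longleftrightarrow>
    s \<in> P \<and> (\<forall>a\<in>A. le s a) \<and> (\<forall>u\<in>P. (\<forall>a\<in>A. le u a) \<longrightarrow> le u s)"

definition directed_index :: "'i set \<Rightarrow> ('i \<Rightarrow> 'i \<Rightarrow> bool) \<Rightarrow> bool"
  where "directed_index \<Gamma> r \<longleftrightarrow>
    \<Gamma> \<noteq> {} \<and> (\<forall>a\<in>\<Gamma>. r a a) \<and>
    (\<forall>a\<in>\<Gamma>. \<forall>b\<in>\<Gamma>. \<forall>c\<in>\<Gamma>. r a b \<longrightarrow> r b c \<longrightarrow> r a c) \<and>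
    (\<forall>a\<in>\<Gamma>. \<forall>b\<in>\<Gamma>. \<exists>c\<in>\<Gamma>. r a c \<and> r b c)"

definition order_convergent ::
    "'a set \<Rightarrow> ('a \<Rightarrow> 'a \<Rightarrow> bool) \<Rightarrow> 'i set \<Rightarrow> ('i \<Rightarrow> 'i \<Rightarrow> bool) \<Rightarrow> ('i \<Rightarrow> 'a) \<Rightarrow> 'a \<Rightarrow> bool"
  where "order_convergent P le \<Gamma> r x l \<longleftrightarrow>
    (\<exists>y z. y ` \<Gamma> \<subseteq> P \<and> z ` \<Gamma> \<subseteq> P \<and>
      (\<forall>a\<in>\<Gamma>. le (y a) (x a) \<and> le (x a) (z a)) \<and>
      (\<forall>a\<in>\<Gamma>. \<forall>b\<in>\<Gamma>. r a b \<longrightarrow> le (y a) (y b)) \<and> is_supremum P le (y ` \<Gamma>) l \<and>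
      (\<forall>a\<in>\<Gamma>. \<forall>b\<in>\<Gamma>. r a b \<longrightarrow> le (z b) (z a)) \<and> is_infimum P le (z ` \<Gamma>) l)"

text \<open>A definition in HOL cannot quantify over all index types. Index sets inside
  \<^typ>\<open>'a \<times> 'a \<times> 'a\<close> suffice: a net \<open>x\<close> enclosed by \<open>y\<close> and \<open>z\<close> can be reindexed by the
  triples \<open>(y a, x a, z a)\<close>; see \<open>order_closedD\<close> below for nets over an arbitrary index type.\<close>

definition order_closed :: "'a set \<Rightarrow> ('a \<Rightarrow> 'a \<Rightarrow> bool) \<Rightarrow> 'a set \<Rightarrow> bool"
  where "order_closed P le C \<longleftrightarrow> C \<subseteq> P \<and>
    \<not> (\<exists>(\<Gamma> :: ('a \<times> 'a \<times> 'a) set) r x l. directed_index \<Gamma> r \<and> x ` \<Gamma> \<subseteq> C \<and>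
        l \<in> P - C \<and> order_convergent P le \<Gamma> r x l)"

text \<open>For a transitive \<open>le\<close> the complements of the order closed sets do form a topology; see
  \<open>openin_order_topology\<close> below.\<close>

definition order_topology :: "'a set \<Rightarrow> ('a \<Rightarrow> 'a \<Rightarrow> bool) \<Rightarrow> 'a topology"
  where "order_topology P le = topology (\<lambda>U. U \<subseteq> P \<and> order_closed P le (P - U))"

lemma order_closedD:
  fixes \<Gamma> :: "'i set" and P :: "'a set"
  assumes trans: "\<And>a b c. \<lbrakk>a \<in> P; b \<in> P; c \<in> P; le a b; le b c\<rbrakk> \<Longrightarrow> le a c"
    and refl: "\<And>a. a \<in> P \<Longrightarrow> le a a"
    and C: "order_closed P le C" and dir: "directed_index \<Gamma> r" and x: "x ` \<Gamma> \<subseteq> C"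
    and conv: "order_convergent P le \<Gamma> r x l"
  shows "l \<in> C"
proof (rule ccontr)
  assume "l \<notin> C"
  have CP: "C \<subseteq> P" using C by (simp add: order_closed_def)
  from conv obtain y z where yP: "y ` \<Gamma> \<subseteq> P" and zP: "z ` \<Gamma> \<subseteq> P"
    and yxz: "\<forall>a\<in>\<Gamma>. le (y a) (x a) \<and> le (x a) (z a)"
    and y: "\<forall>a\<in>\<Gamma>. \<forall>b\<in>\<Gamma>. r a b \<longrightarrow> le (y a) (y b)" "is_supremum P le (y ` \<Gamma>) l"
    and z: "\<forall>a\<in>\<Gamma>. \<forall>b\<in>\<Gamma>. r a b \<longrightarrow> le (z b) (z a)" "is_infimum P le (z ` \<Gamma>) l"
    unfolding order_convergent_def by blast
  have lP: "l \<in> P" using y(2) by (simp add: is_supremum_def)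
  define D where "D = (\<lambda>a. (y a, x a, z a)) ` \<Gamma>"
  define s :: "'a \<times> 'a \<times> 'a \<Rightarrow> 'a \<times> 'a \<times> 'a \<Rightarrow> bool"
    where "s = (\<lambda>p q. le (fst p) (fst q) \<and> le (snd (snd q)) (snd (snd p)))"
  have DP: "fst p \<in> P" "snd (snd p) \<in> P" if "p \<in> D" for p
    using that yP zP by (auto simp: D_def)
  have "directed_index D s"
    unfolding directed_index_def
  proof (intro conjI ballI impI)
    show "D \<noteq> {}" using dir by (auto simp: D_def directed_index_def)
    show "s p p" if "p \<in> D" for p
      using DP[OF that] refl by (simp add: s_def)
    show "s p u" if "p \<in> D" "q \<in> D" "u \<in> D" "s p q" "s q u" for p q u
      using that(4,5) trans[OF DP(1)[OF that(1)] DP(1)[OF that(2)] DP(1)[OF that(3)]]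
        trans[OF DP(2)[OF that(3)] DP(2)[OF that(2)] DP(2)[OF that(1)]]
      by (simp add: s_def)
    show "\<exists>u\<in>D. s p u \<and> s q u" if "p \<in> D" "q \<in> D" for p q
    proof -
      from that obtain a b where ab: "a \<in> \<Gamma>" "b \<in> \<Gamma>"
        and pq: "p = (y a, x a, z a)" "q = (y b, x b, z b)" by (auto simp: D_def)
      from ab dir obtain c where c: "c \<in> \<Gamma>" "r a c" "r b c"
        unfolding directed_index_def by meson
      with ab y(1) z(1) have "le (y a) (y c)" "le (y b) (y c)" "le (z c) (z a)" "le (z c) (z b)"
        by simp_all
      then have "s p (y c, x c, z c) \<and> s q (y c, x c, z c)" by (simp add: pq s_def)
      moreover from c(1) have "(y c, x c, z c) \<in> D" unfolding D_def by (rule imageI)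
      ultimately show ?thesis by blast
    qed
  qed
  moreover have "order_convergent P le D s (\<lambda>p. fst (snd p)) l"
  proof -
    have img: "fst ` D = y ` \<Gamma>" "(\<lambda>p. snd (snd p)) ` D = z ` \<Gamma>"
      by (simp_all add: D_def image_image)
    show ?thesis
      unfolding order_convergent_def
      by (rule exI[of _ fst], rule exI[of _ "\<lambda>p. snd (snd p)"], unfold img)
        (use yP zP y(2) z(2) yxz in \<open>auto simp: s_def D_def\<close>)
  qed
  moreover have "(\<lambda>p. fst (snd p)) ` D \<subseteq> C" using x by (auto simp: D_def)
  ultimately show False
    using C \<open>l \<notin> C\<close> lP unfolding order_closed_def by blast
qed

lemma order_convergent_cofinal:
  assumes trans: "\<And>a b c. \<lbrakk>a \<in> P; b \<in> P; c \<in> P; le a b; le b c\<rbrakk> \<Longrightarrow> le a c"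
    and conv: "order_convergent P le \<Gamma> r x l"
    and sub: "A \<subseteq> \<Gamma>" and cof: "\<And>a. a \<in> \<Gamma> \<Longrightarrow> \<exists>b\<in>A. r a b"
  shows "order_convergent P le A r x l"
proof -
  from conv obtain y z where yP: "y ` \<Gamma> \<subseteq> P" and zP: "z ` \<Gamma> \<subseteq> P"
    and yxz: "\<forall>a\<in>\<Gamma>. le (y a) (x a) \<and> le (x a) (z a)"
    and y: "\<forall>a\<in>\<Gamma>. \<forall>b\<in>\<Gamma>. r a b \<longrightarrow> le (y a) (y b)" "is_supremum P le (y ` \<Gamma>) l"
    and z: "\<forall>a\<in>\<Gamma>. \<forall>b\<in>\<Gamma>. r a b \<longrightarrow> le (z b) (z a)" "is_infimum P le (z ` \<Gamma>) l"
    unfolding order_convergent_def by blast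
  have ub: "\<forall>a\<in>\<Gamma>. le (y a) u" if "u \<in> P" "\<forall>a\<in>A. le (y a) u" for u
  proof
    fix a assume "a \<in> \<Gamma>"
    with cof obtain b where "b \<in> A" "r a b" by blast
    then have "y a \<in> P" "y b \<in> P" "le (y a) (y b)" using \<open>a \<in> \<Gamma>\<close> \<open>b \<in> A\<close> sub y(1) yP by blast+
    then show "le (y a) u" using trans[of "y a" "y b" u] that \<open>b \<in> A\<close> by simp
  qed
  have lb: "\<forall>a\<in>\<Gamma>. le u (z a)" if "u \<in> P" "\<forall>a\<in>A. le u (z a)" for u
  proof
    fix a assume "a \<in> \<Gamma>"
    with cof obtain b where "b \<in> A" "r a b" by blast
    then have "z a \<in> P" "z b \<in> P" "le (z b) (z a)" using \<open>a \<in> \<Gamma>\<close> \<open>b \<in> A\<close> sub z(1) zP by blast+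
    then show "le u (z a)" using trans[of u "z b" "z a"] that \<open>b \<in> A\<close> by simp
  qed
  have "is_supremum P le (y ` A) l"
    using y(2) ub sub unfolding is_supremum_def by (simp add: subset_iff)
  moreover have "is_infimum P le (z ` A) l"
    using z(2) lb sub unfolding is_infimum_def by (simp add: subset_iff)
  ultimately show ?thesis
    unfolding order_convergent_def using yP zP yxz y(1) z(1) sub
    by (intro exI[of _ y] exI[of _ z]) (auto simp: subset_iff)
qed

lemma order_closed_Un:
  assumes trans: "\<And>a b c. \<lbrakk>a \<in> P; b \<in> P; c \<in> P; le a b; le b c\<rbrakk> \<Longrightarrow> le a c"
    and C: "order_closed P le C" and D: "order_closed P le D"
  shows "order_closed P le (C \<union> D)"
proof -
  have False if dir: "directed_index \<Gamma> r" and x: "x ` \<Gamma> \<subseteq> C \<union> D" and l: "l \<in> P - (C \<union> D)"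
    and conv: "order_convergent P le \<Gamma> r x l"
    for \<Gamma> :: "('a \<times> 'a \<times> 'a) set" and r x l
  proof -
    from dir have ne: "\<Gamma> \<noteq> {}" and rr: "\<And>a. a \<in> \<Gamma> \<Longrightarrow> r a a"
      and rt: "\<And>a b c. \<lbrakk>a \<in> \<Gamma>; b \<in> \<Gamma>; c \<in> \<Gamma>; r a b; r b c\<rbrakk> \<Longrightarrow> r a c"
      and rd: "\<And>a b. \<lbrakk>a \<in> \<Gamma>; b \<in> \<Gamma>\<rbrakk> \<Longrightarrow> \<exists>c\<in>\<Gamma>. r a c \<and> r b c"
      unfolding directed_index_def by metis+
    have no_cofinal: "\<not> (\<forall>a\<in>\<Gamma>. \<exists>b\<in>{b\<in>\<Gamma>. x b \<in> E}. r a b)"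
      if E: "order_closed P le E" "l \<notin> E" for E
    proof
      assume cof: "\<forall>a\<in>\<Gamma>. \<exists>b\<in>{b\<in>\<Gamma>. x b \<in> E}. r a b"
      let ?A = "{b\<in>\<Gamma>. x b \<in> E}"
      have "directed_index ?A r"
        unfolding directed_index_def
      proof (intro conjI ballI impI)
        show "?A \<noteq> {}" using cof ne by blast
        show "r a a" if "a \<in> ?A" for a
          using that rr by simp
        show "r a c" if "a \<in> ?A" "b \<in> ?A" "c \<in> ?A" "r a b" "r b c" for a b c
          using that rt[of a b c] by simp
        show "\<exists>c\<in>?A. r a c \<and> r b c" if ab: "a \<in> ?A" "b \<in> ?A" for a b
        proof -
          from ab rd obtain c where c: "c \<in> \<Gamma>" "r a c" "r b c" by blast
          with cof obtain d where "d \<in> ?A" "r c d" by blast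
          with c ab rt[of a c d] rt[of b c d] show ?thesis by blast
        qed
      qed
      moreover have "order_convergent P le ?A r x l"
        by (rule order_convergent_cofinal[OF trans conv]) (use cof in auto)
      ultimately show False
        using E l unfolding order_closed_def by blast
    qed
    from no_cofinal[OF C] l obtain a where a: "a \<in> \<Gamma>" "\<forall>b\<in>\<Gamma>. r a b \<longrightarrow> x b \<notin> C" by blast
    from no_cofinal[OF D] l obtain b where b: "b \<in> \<Gamma>" "\<forall>c\<in>\<Gamma>. r b c \<longrightarrow> x c \<notin> D" by blast
    from rd[OF a(1) b(1)] obtain c where "c \<in> \<Gamma>" "r a c" "r b c" by blast
    with a b x show False by blast
  qed
  moreover have "C \<union> D \<subseteq> P" using C D by (simp add: order_closed_def)
  ultimately show ?thesis unfolding order_closed_def by blast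
qed

lemma order_closed_Inter:
  assumes "\<And>C. C \<in> K \<Longrightarrow> order_closed P le C"
  shows "order_closed P le (P \<inter> \<Inter>K)"
  unfolding order_closed_def
proof (intro conjI notI; (elim exE conjE)?)
  fix \<Gamma> :: "('a \<times> 'a \<times> 'a) set" and r x l
  assume *: "directed_index \<Gamma> r" "x ` \<Gamma> \<subseteq> P \<inter> \<Inter>K" "l \<in> P - P \<inter> \<Inter>K"
    "order_convergent P le \<Gamma> r x l"
  then obtain C where "C \<in> K" "l \<in> P - C" by blast
  moreover from this * have "x ` \<Gamma> \<subseteq> C" by blast
  ultimately show False
    using * assms[of C] unfolding order_closed_def by blast
qed simp

lemma openin_order_topology:
  assumes trans: "\<And>a b c. \<lbrakk>a \<in> P; b \<in> P; c \<in> P; le a b; le b c\<rbrakk> \<Longrightarrow> le a c"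
  shows "openin (order_topology P le) U \<longleftrightarrow> U \<subseteq> P \<and> order_closed P le (P - U)"
proof -
  have "istopology (\<lambda>U. U \<subseteq> P \<and> order_closed P le (P - U))"
    unfolding istopology_def
  proof (intro conjI allI impI; (elim conjE)?)
    fix S T assume "order_closed P le (P - S)" "order_closed P le (P - T)" "S \<subseteq> P"
    then show "order_closed P le (P - S \<inter> T)"
      unfolding Diff_Int by (intro order_closed_Un[OF trans])
    show "S \<inter> T \<subseteq> P" using \<open>S \<subseteq> P\<close> by blast
  next
    fix K assume K: "\<forall>S\<in>K. S \<subseteq> P \<and> order_closed P le (P - S)"
    then show "\<Union>K \<subseteq> P" by blast
    have "order_closed P le (P \<inter> \<Inter>((\<lambda>S. P - S) ` K))"
      by (rule order_closed_Inter) (use K in auto)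
    also have "P \<inter> \<Inter>((\<lambda>S. P - S) ` K) = P - \<Union>K" by blast
    finally show "order_closed P le (P - \<Union>K)" .
  qed
  then show ?thesis by (simp add: order_topology_def)
qed

end

theory Submission
  imports Defs
begin

text \<open>
Write \<open>e\<close> for the unit of \<open>M\<close>. Two facts about the star order carry the proof.

First, nonzero multiples of \<open>e\<close> are maximal: if \<open>x\<close> is one of them, then \<open>x\<^sup>* x = x\<^sup>* z\<close> can be
cancelled to \<open>z = x\<close> (\<open>scaled_unit_maximal\<close>). A net of such elements can only be order convergent to one
of its own members, because the decreasing net above it lies above maximal elements and is therefore constant.
Hence the set of all \<open>e / (n + 1)\<close> is order closed. It is not norm closed, as \<open>0\<close> is missing,
so its complement is open in the order topology and not in the norm topology.

Second, on projections the star order is the usual order. Suppose that \<open>P n\<close> is an increasing sequence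
of projections different from \<open>e\<close> such that \<open>P n u = P n\<close> for all \<open>n\<close> forces \<open>u = e\<close>. Then \<open>e\<close> is the only
upper bound of the sequence in \<open>M\<close>, so the sequence is order convergent to \<open>e\<close>, enclosed between itself
and the constant \<open>e\<close>. No \<open>P n\<close> is invertible, and every \<open>P n\<close> has distance at least \<open>1\<close> from \<open>e\<close>. Therefore
neither the set of noninvertible elements nor the norm closed set of all \<open>x\<close> with \<open>norm (x - e) \<ge> 1\<close> is order
closed (\<open>not_order_closed_if_no_unit\<close>).

It remains to find such a sequence in an infinite-dimensional \<open>M\<close> (\<open>increasing_projections_to_unit\<close>). Given a
strictly decreasing sequence of projections \<open>F n\<close> in \<open>M\<close>, let \<open>E\<close> be the supremum of the projections \<open>e - F n\<close>
and take \<open>P n = (e - E) + (e - F n)\<close>. If there is no such sequence \<open>F\<close>, then the strict order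
of projections is well-founded, and \<open>e\<close> is a finite sum of minimal projections (\<open>sum_of_minimal\<close>). For minimal \<open>p\<close>
and \<open>q\<close> the space \<open>p M q\<close> is at most one-dimensional (\<open>minimal_off_corner\<close>), so \<open>M = e M e\<close> has finite dimension.

The operator theory behind this avoids the spectral theorem. Range projections of selfadjoint elements are strong limits
of polynomials (\<open>range_projection\<close>), suprema of directed families of projections are strong limits of the
family (\<open>sup_projection\<close>), and the supremum of all projections is the unit (\<open>unit_exists\<close>). That \<open>p M p\<close> consists of
multiples of a minimal \<open>p\<close> needs, besides range projections, only the absolute value of a selfadjoint
element (\<open>absolute_value\<close>).
\<close>

section \<open>Orthogonal decomposition and adjoints\<close>

instance chilbert_space \<subseteq> banach ..

text \<open>The parallelogram law, centred at a point \<open>x\<close>: it shows that a sequence in a convex set whose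
distances to \<open>x\<close> approach the infimum is a Cauchy sequence.\<close>

lemma parallelogram_midpoint:
  fixes x u v :: "'a :: real_inner"
  shows "(norm (u - v))\<^sup>2 = 2 * (norm (x - u))\<^sup>2 + 2 * (norm (x - v))\<^sup>2
    - 4 * (norm (x - (1/2) *\<^sub>R (u + v)))\<^sup>2"
  unfolding power2_norm_eq_inner
  by (simp add: inner_simps inner_commute algebra_simps)

lemma orthogonal_decomposition:
  fixes V :: "'a :: {real_inner, complete_space} set"
  assumes V: "subspace V" and cl: "closed V"
  obtains v where "v \<in> V" "\<And>w. w \<in> V \<Longrightarrow> inner (x - v) w = 0"
proof -
  define d where "d = (INF v\<in>V. (norm (x - v))\<^sup>2)"
  have ne: "V \<noteq> {}" using V subspace_0 by blast
  have bdd: "bdd_below ((\<lambda>v. (norm (x - v))\<^sup>2) ` V)"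
    by (rule bdd_belowI[of _ 0]) auto
  have d: "d \<le> (norm (x - v))\<^sup>2" if "v \<in> V" for v
    unfolding d_def by (rule cINF_lower[OF bdd that])
  have "\<exists>v\<in>V. (norm (x - v))\<^sup>2 < d + inverse (real (Suc n))" for n
  proof -
    have "d < d + inverse (real (Suc n))" by simp
    then show ?thesis unfolding d_def using cINF_less_iff[OF ne bdd] by blast
  qed
  then obtain s where s: "\<And>n. s n \<in> V" "\<And>n. (norm (x - s n))\<^sup>2 < d + inverse (real (Suc n))"
    by metis
  have dist: "(norm (s m - s n))\<^sup>2 \<le> 2 * inverse (real (Suc m)) + 2 * inverse (real (Suc n))" for m n
  proof -
    have "(1/2) *\<^sub>R (s m + s n) \<in> V"
      using V s(1) by (intro subspace_scale subspace_add)
    from d[OF this] show ?thesis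
      using s(2)[of m] s(2)[of n] unfolding parallelogram_midpoint[of "s m" "s n" x] by linarith
  qed
  have "Cauchy s"
  proof (rule metric_CauchyI)
    fix e :: real assume "0 < e"
    then obtain N where N: "inverse (real (Suc N)) < e\<^sup>2 / 4"
      using reals_Archimedean[of "e\<^sup>2/4"] by auto
    show "\<exists>M. \<forall>m\<ge>M. \<forall>n\<ge>M. dist (s m) (s n) < e"
    proof (intro exI allI impI)
      fix m n assume "N \<le> m" "N \<le> n"
      then have "inverse (real (Suc m)) \<le> inverse (real (Suc N))"
        "inverse (real (Suc n)) \<le> inverse (real (Suc N))"
        by (simp_all add: le_imp_inverse_le)
      then have "(norm (s m - s n))\<^sup>2 < e\<^sup>2" using dist[of m n] N by linarith
      then show "dist (s m) (s n) < e"
        using \<open>0 < e\<close> by (simp add: dist_norm power2_less_imp_less)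
    qed
  qed
  then obtain v where lim: "s \<longlonglongrightarrow> v" using Cauchy_convergent_iff convergent_def by blast
  have v: "v \<in> V" using closed_sequentially[OF cl] s(1) lim by blast
  have "(\<lambda>n. (norm (x - s n))\<^sup>2) \<longlonglongrightarrow> (norm (x - v))\<^sup>2"
    by (intro tendsto_intros lim)
  moreover have "(\<lambda>n. d + inverse (real (Suc n))) \<longlonglongrightarrow> d + 0"
    by (intro tendsto_intros LIMSEQ_inverse_real_of_nat)
  ultimately have vd: "(norm (x - v))\<^sup>2 \<le> d"
    using LIMSEQ_le s(2) less_imp_le by (metis (no_types, lifting) add.right_neutral)
  have "inner (x - v) w = 0" if w: "w \<in> V" for w
  proof (cases "w = 0")
    case False
    \<comment> \<open>\<open>v + t w\<close> is the point of the line through \<open>v\<close> in direction \<open>w\<close> that is closest to \<open>x\<close>\<close>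
    define c where "c = inner (x - v) w"
    define t where "t = c / inner w w"
    have ww: "inner w w > 0" using False by simp
    have "v + t *\<^sub>R w \<in> V" using V v w by (intro subspace_scale subspace_add)
    from vd d[OF this] have "(norm (x - v))\<^sup>2 \<le> (norm (x - (v + t *\<^sub>R w)))\<^sup>2"
      by (rule order_trans)
    also have "\<dots> = (norm (x - v))\<^sup>2 - 2 * t * c + t\<^sup>2 * inner w w"
      unfolding power2_norm_eq_inner c_def
      by (simp add: inner_simps inner_commute algebra_simps power2_eq_square)
    also have "\<dots> = (norm (x - v))\<^sup>2 - c\<^sup>2 / inner w w"
      using ww by (simp add: t_def field_simps power2_eq_square)
    finally have "c\<^sup>2 / inner w w \<le> 0" by simp
    then have "c\<^sup>2 \<le> 0" using ww by (simp add: divide_le_0_iff)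
    then show ?thesis by (simp add: c_def)
  qed simp
  with v show ?thesis by (rule that)
qed

text \<open>A nonzero functional \<open>f\<close> is determined up to a factor by its kernel, and so is a vector \<open>u\<close>
orthogonal to that kernel; comparing the two on \<open>u\<close> itself gives the factor.\<close>

lemma riesz_representation:
  fixes f :: "'a :: {real_inner, complete_space} \<Rightarrow> real"
  assumes f: "bounded_linear f"
  obtains z where "\<And>x. f x = inner x z"
proof (cases "\<forall>x. f x = 0")
  case True
  then show ?thesis using that[of 0] by simp
next
  case False
  then obtain a where a: "f a \<noteq> 0" by blast
  interpret f: bounded_linear f by fact
  have "subspace {x. f x = 0}"
    by (rule subspaceI) (simp_all add: f.add f.scaleR)
  moreover have "closed {x. f x = 0}"
    by (intro closed_Collect_eq f.continuous_on continuous_intros)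
  ultimately obtain v where v: "f v = 0" "\<And>w. f w = 0 \<Longrightarrow> inner (a - v) w = 0"
    using orthogonal_decomposition[of "{x. f x = 0}" a] by auto
  define u where "u = a - v"
  have fu: "f u \<noteq> 0" using a v(1) by (simp add: u_def f.diff)
  then have uu: "inner u u \<noteq> 0" by auto
  have "f x = inner x ((f u / inner u u) *\<^sub>R u)" for x
  proof -
    have "f (x - (f x / f u) *\<^sub>R u) = 0" using fu by (simp add: f.diff f.scaleR)
    then have "inner u (x - (f x / f u) *\<^sub>R u) = 0" using v(2) by (simp add: u_def)
    then have "inner u x = f x / f u * inner u u" by (simp add: inner_simps)
    then show ?thesis using fu uu by (simp add: inner_commute field_simps)
  qed
  then show ?thesis by (rule that)
qed

lemma inner_eq_all_imp_eq: "(\<And>x. inner x y = inner x z) \<Longrightarrow> y = (z :: 'a :: real_inner)"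
  by (metis inner_commute vector_eq_rdot)

lemma adjoint_exists:
  fixes T :: "'a :: {real_inner, complete_space} \<Rightarrow>\<^sub>L 'a"
  obtains S :: "'a \<Rightarrow>\<^sub>L 'a" where "\<And>x y. inner (T x) y = inner x (S y)"
proof -
  have "\<exists>z. \<forall>x. inner (T x) y = inner x z" for y
  proof -
    have "bounded_linear (\<lambda>x. inner (T x) y)"
      by (intro bounded_linear_inner_left_comp blinfun.bounded_linear_right)
    then show ?thesis using riesz_representation[of "\<lambda>x. inner (T x) y"] by metis
  qed
  then obtain s where s: "\<And>x y. inner (T x) y = inner x (s y)" by metis
  have "bounded_linear s"
  proof (rule bounded_linear_intro[where K = "norm T"])
    show "s (y + z) = s y + s z" for y z
      by (rule inner_eq_all_imp_eq) (simp add: s[symmetric] inner_add_right)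
    show "s (r *\<^sub>R y) = r *\<^sub>R s y" for r y
      by (rule inner_eq_all_imp_eq) (simp add: s[symmetric])
    show "norm (s y) \<le> norm y * norm T" for y
    proof (cases "s y = 0")
      case False
      have "(norm (s y))\<^sup>2 = inner (T (s y)) y" by (simp add: s power2_norm_eq_inner)
      also have "\<dots> \<le> norm (T (s y)) * norm y" by (rule norm_cauchy_schwarz)
      also have "\<dots> \<le> (norm T * norm (s y)) * norm y"
        by (intro mult_right_mono norm_blinfun) simp
      finally show ?thesis using False by (simp add: power2_eq_square mult.commute mult.left_commute)
    qed simp
  qed
  then show ?thesis using s that[of "Blinfun s"] by (simp add: bounded_linear_Blinfun_apply)
qed

text \<open>The real inner product suffices for adjoints: of the complex structure one only needs that
multiplication by \<open>c\<close> has adjoint multiplication by \<open>cnj c\<close>, and that the imaginary part of the complex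
inner product is a real inner product with \<open>\<i> x\<close>.\<close>

lemma inner_scaleC_adjoint: "inner (c *\<^sub>C x) y = inner x (cnj c *\<^sub>C (y :: 'a :: complex_inner))"
  by (simp add: inner_eq_Re_cinner cinner_scaleC_left cinner_scaleC_right)

lemma Im_cinner: "Im (cinner x y) = - inner (\<i> *\<^sub>C x) y"
  by (simp add: inner_eq_Re_cinner cinner_scaleC_left)

lemma bounded_operatorsD: "T \<in> bounded_operators \<Longrightarrow> T (c *\<^sub>C x) = c *\<^sub>C T x"
  by (simp add: bounded_operators_def)

lemma adj_eqI:
  fixes T S :: "'h :: chilbert_space \<Rightarrow>\<^sub>L 'h"
  assumes T: "T \<in> bounded_operators" and S: "\<And>x y. inner (T x) y = inner x (S y)"
  shows "adj T = S"
  unfolding adj_def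
proof (rule the_equality)
  show "\<forall>x y. cinner (T x) y = cinner x (S y)"
    by (simp add: complex_eq_iff Im_cinner S flip: inner_eq_Re_cinner bounded_operatorsD[OF T])
next
  fix R assume R: "\<forall>x y. cinner (T x) y = cinner x (blinfun_apply R y)"
  show "R = S"
    by (rule blinfun_eqI, rule inner_eq_all_imp_eq) (metis R S inner_eq_Re_cinner)
qed

lemma inner_adj:
  fixes T :: "'h :: chilbert_space \<Rightarrow>\<^sub>L 'h"
  assumes "T \<in> bounded_operators"
  shows "inner (T x) y = inner x (adj T y)"
  using adjoint_exists[of T] adj_eqI[OF assms] by metis

section \<open>Selfadjoint operators and projections\<close>

definition selfadjoint :: "('a :: real_inner \<Rightarrow>\<^sub>L 'a) \<Rightarrow> bool"
  where "selfadjoint T \<longleftrightarrow> (\<forall>x y. inner (T x) y = inner x (T y))"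

definition projection :: "('a :: real_inner \<Rightarrow>\<^sub>L 'a) \<Rightarrow> bool"
  where "projection P \<longleftrightarrow> selfadjoint P \<and> P o\<^sub>L P = P"

lemma projection_idem: "projection P \<Longrightarrow> P (P x) = P x"
  by (metis projection_def blinfun_apply_blinfun_compose)

lemma projection_inner: "projection P \<Longrightarrow> inner (P x) y = inner x (P y)"
  by (simp add: projection_def selfadjoint_def)

lemma projection_inner_self: "projection P \<Longrightarrow> inner (P x) x = (norm (P x))\<^sup>2"
  by (metis projection_inner projection_idem power2_norm_eq_inner)

lemma projection_norm_le: "projection P \<Longrightarrow> norm (P x) \<le> norm x"
proof -
  assume "projection P"
  then have "(norm (P x))\<^sup>2 \<le> norm (P x) * norm x"
    using norm_cauchy_schwarz[of "P x" x] by (simp add: projection_inner_self)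
  then show ?thesis by (cases "P x = 0") (simp_all add: power2_eq_square)
qed

text \<open>Complex linearity comes for free: the orthogonal complement of a complex subspace is complex,
and the decomposition of a vector is unique.\<close>

lemma projection_onto:
  fixes V :: "'h :: chilbert_space set"
  assumes V: "subspace V" and cl: "closed V" and cV: "\<And>c v. v \<in> V \<Longrightarrow> c *\<^sub>C v \<in> V"
  obtains P where "P \<in> bounded_operators" "projection P" "\<And>x. P x \<in> V" "\<And>v. v \<in> V \<Longrightarrow> P v = v"
    "\<And>x. (\<And>w. w \<in> V \<Longrightarrow> inner x w = 0) \<Longrightarrow> P x = 0"
proof -
  have "\<exists>v. v \<in> V \<and> (\<forall>w\<in>V. inner (x - v) w = 0)" for x
    using orthogonal_decomposition[OF V cl] by metis
  then obtain p where p: "\<And>x. p x \<in> V" "\<And>x w. w \<in> V \<Longrightarrow> inner (x - p x) w = 0" by metis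
  have uniq: "p x = v" if "v \<in> V" "\<And>w. w \<in> V \<Longrightarrow> inner (x - v) w = 0" for x v
  proof -
    have m: "p x - v \<in> V" by (rule subspace_diff[OF V p(1) that(1)])
    have "inner (p x - v) (p x - v) = inner (x - v) (p x - v) - inner (x - p x) (p x - v)"
      by (simp add: inner_simps)
    also have "\<dots> = 0" using that(2)[OF m] p(2)[OF m] by simp
    finally show ?thesis by simp
  qed
  have sa: "inner (p x) y = inner x (p y)" for x y
    using p(2)[OF p(1), of x y] p(2)[OF p(1), of y x] by (simp add: inner_simps inner_commute)
  have idem: "p v = v" if "v \<in> V" for v
    by (rule uniq[OF that]) simp
  have "bounded_linear p"
  proof (rule bounded_linear_intro[where K = 1])
    show "p (x + y) = p x + p y" for x y
    proof (rule uniq)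
      show "p x + p y \<in> V" by (intro subspace_add V p)
      show "inner (x + y - (p x + p y)) w = 0" if "w \<in> V" for w
        using p(2)[OF that, of x] p(2)[OF that, of y] by (simp add: inner_simps)
    qed
    show "p (r *\<^sub>R x) = r *\<^sub>R p x" for r x
    proof (rule uniq)
      show "r *\<^sub>R p x \<in> V" by (intro subspace_scale V p)
      show "inner (r *\<^sub>R x - r *\<^sub>R p x) w = 0" if "w \<in> V" for w
        using p(2)[OF that, of x] by (simp flip: scaleR_diff_right)
    qed
    show "norm (p x) \<le> norm x * 1" for x
    proof -
      have "(norm (p x))\<^sup>2 = inner x (p x)"
        using sa[of x "p x"] idem[OF p(1), of x] by (simp add: power2_norm_eq_inner)
      also have "\<dots> \<le> norm x * norm (p x)" by (rule norm_cauchy_schwarz)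
      finally show ?thesis by (cases "p x = 0") (simp_all add: power2_eq_square)
    qed
  qed
  then have P: "blinfun_apply (Blinfun p) = p" by (rule bounded_linear_Blinfun_apply)
  have pc: "p (c *\<^sub>C x) = c *\<^sub>C p x" for c x
  proof (rule uniq)
    show "c *\<^sub>C p x \<in> V" by (intro cV p)
    show "inner (c *\<^sub>C x - c *\<^sub>C p x) w = 0" if "w \<in> V" for w
    proof -
      have "c *\<^sub>C x - c *\<^sub>C p x = c *\<^sub>C (x - p x)"
        by (simp add: complex_vector.scale_right_diff_distrib)
      then show ?thesis using p(2)[OF cV[OF that]] by (simp add: inner_scaleC_adjoint)
    qed
  qed
  show ?thesis
  proof
    show "Blinfun p \<in> bounded_operators" by (simp add: bounded_operators_def P pc)
    show "projection (Blinfun p)"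
      unfolding projection_def selfadjoint_def using sa idem[OF p(1)]
      by (auto intro!: blinfun_eqI simp: P)
    show "blinfun_apply (Blinfun p) x \<in> V" for x by (simp add: P p)
    show "blinfun_apply (Blinfun p) v = v" if "v \<in> V" for v using that by (simp add: P idem)
    show "blinfun_apply (Blinfun p) x = 0" if "\<And>w. w \<in> V \<Longrightarrow> inner x w = 0" for x
      unfolding P by (rule uniq) (use that subspace_0[OF V] in auto)
  qed
qed

lemma selfadjointD: "selfadjoint T \<Longrightarrow> inner (T x) y = inner x (T y)"
  by (simp add: selfadjoint_def)

lemma selfadjoint_add: "selfadjoint S \<Longrightarrow> selfadjoint T \<Longrightarrow> selfadjoint (S + T)"
  by (simp add: selfadjoint_def blinfun.add_left inner_add_left inner_add_right)

lemma selfadjoint_diff: "selfadjoint S \<Longrightarrow> selfadjoint T \<Longrightarrow> selfadjoint (S - T)"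
  by (simp add: selfadjoint_def blinfun.diff_left inner_diff_left inner_diff_right)

lemma selfadjoint_scaleR: "selfadjoint T \<Longrightarrow> selfadjoint (r *\<^sub>R T)"
  by (simp add: selfadjoint_def blinfun.scaleR_left)

lemma selfadjoint_square: "selfadjoint T \<Longrightarrow> selfadjoint (T o\<^sub>L T)"
  by (simp add: selfadjoint_def)

lemma compose_eqD: "S o\<^sub>L T = R \<Longrightarrow> S (T x) = R x"
  by (metis blinfun_apply_blinfun_compose)

text \<open>Taking adjoints in \<open>S T = R\<close>.\<close>

lemma selfadjoint_product_commute:
  assumes "selfadjoint S" "selfadjoint T" "selfadjoint R" "S o\<^sub>L T = R"
  shows "T o\<^sub>L S = R"
proof (rule blinfun_eqI, rule inner_eq_all_imp_eq)
  fix x y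
  have "inner x ((T o\<^sub>L S) y) = inner (S (T x)) y"
    using assms(1,2) by (simp add: selfadjointD)
  also have "\<dots> = inner x (R y)" by (simp add: compose_eqD[OF assms(4)] selfadjointD[OF assms(3)])
  finally show "inner x ((T o\<^sub>L S) y) = inner x (R y)" .
qed

lemma selfadjoint_absorb_commute:
  assumes "projection p" "selfadjoint T" "p o\<^sub>L T = T"
  shows "T o\<^sub>L p = T"
  using selfadjoint_product_commute[of p T T] assms by (simp add: projection_def)

lemma projection_absorb_commute:
  assumes "projection p" "projection q"
  shows "p o\<^sub>L q = q \<longleftrightarrow> q o\<^sub>L p = q"
  using selfadjoint_product_commute[of p q q] selfadjoint_product_commute[of q p q] assms
  by (auto simp: projection_def)

lemma adj_selfadjoint: "T \<in> bounded_operators \<Longrightarrow> selfadjoint T \<Longrightarrow> adj T = T"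
  by (rule adj_eqI) (simp_all add: selfadjointD)

text \<open>Polarization: expand the form at \<open>x + y\<close>.\<close>

lemma selfadjoint_zero_form:
  assumes "selfadjoint S" "\<And>x. inner (S x) x = 0"
  shows "S = 0"
proof (rule blinfun_eqI, rule inner_eq_all_imp_eq)
  fix x y
  have "inner (S (x + y)) (x + y) = 2 * inner y (S x)"
    using assms(2)[of x] assms(2)[of y] selfadjointD[OF assms(1), of x y]
    by (simp add: blinfun.add_right inner_add_left inner_add_right inner_commute)
  then show "inner y (S x) = inner y ((0 :: 'a \<Rightarrow>\<^sub>L 'a) x)" using assms(2) by simp
qed

lemma subspace_closure:
  fixes V :: "'a :: real_normed_vector set"
  assumes "subspace V"
  shows "subspace (closure V)"
proof (rule subspaceI)
  show "0 \<in> closure V" using subspace_0[OF assms] closure_subset by blast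
  show "x + y \<in> closure V" if "x \<in> closure V" "y \<in> closure V" for x y
  proof -
    from that obtain f g where "\<forall>n. f n \<in> V" "f \<longlonglongrightarrow> x" "\<forall>n. g n \<in> V" "g \<longlonglongrightarrow> y"
      by (auto simp: closure_sequential)
    then show ?thesis unfolding closure_sequential
      by (intro exI[of _ "\<lambda>n. f n + g n"]) (auto intro: tendsto_add subspace_add[OF assms])
  qed
  show "c *\<^sub>R x \<in> closure V" if "x \<in> closure V" for c x
  proof -
    from that obtain f where "\<forall>n. f n \<in> V" "f \<longlonglongrightarrow> x"
      by (auto simp: closure_sequential)
    then show ?thesis unfolding closure_sequential
      by (intro exI[of _ "\<lambda>n. c *\<^sub>R f n"]) (auto intro: tendsto_scaleR subspace_scale[OF assms])
  qed
qed

lemma closure_scaleC: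
  fixes V :: "'a :: complex_inner set"
  assumes "\<And>c v. v \<in> V \<Longrightarrow> c *\<^sub>C v \<in> V" "v \<in> closure V"
  shows "c *\<^sub>C v \<in> closure V"
proof -
  have "continuous_on (closure V) (\<lambda>v. c *\<^sub>C v)"
    by (rule linear_continuous_on[OF bounded_linear_scaleC_right])
  then have "(\<lambda>v. c *\<^sub>C v) ` closure V \<subseteq> closure V"
    by (rule image_closure_subset) (use assms(1) closure_subset in auto)
  then show ?thesis using assms(2) by blast
qed

section \<open>Projections as strong limits\<close>

locale vn_algebra =
  fixes M :: "('h :: chilbert_space \<Rightarrow>\<^sub>L 'h) set"
  assumes vn: "von_neumann_algebra M"
begin

lemma cstar: "cstar_subalgebra M"
  using vn by (simp add: von_neumann_algebra_def)

lemma mem_bounded_operators: "T \<in> M \<Longrightarrow> T \<in> bounded_operators"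
  and mem_compose: "S \<in> M \<Longrightarrow> T \<in> M \<Longrightarrow> S o\<^sub>L T \<in> M"
  and mem_adj: "T \<in> M \<Longrightarrow> adj T \<in> M"
  and closed_M: "closed M"
  using cstar by (auto simp: cstar_subalgebra_def)

lemma subspace_M: "complex_vector.subspace M"
  using cstar by (simp add: cstar_subalgebra_def csubspace_raw_def)

lemma mem_scaleC: "T \<in> M \<Longrightarrow> c *\<^sub>C T \<in> M"
  and mem_add: "S \<in> M \<Longrightarrow> T \<in> M \<Longrightarrow> S + T \<in> M"
  and mem_diff: "S \<in> M \<Longrightarrow> T \<in> M \<Longrightarrow> S - T \<in> M"
  and mem_0: "0 \<in> M"
  using subspace_M complex_vector.subspace_scale complex_vector.subspace_add
    complex_vector.subspace_diff complex_vector.subspace_0 by blast+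

lemma mem_scaleR: "T \<in> M \<Longrightarrow> r *\<^sub>R T \<in> M"
  by (simp add: scaleR_scaleC mem_scaleC)

lemma inner_adj_M: "T \<in> M \<Longrightarrow> inner (T x) y = inner x (adj T y)"
  by (simp add: inner_adj mem_bounded_operators)

lemma adj_eqI_M: "T \<in> M \<Longrightarrow> (\<And>x y. inner (T x) y = inner x (blinfun_apply S y)) \<Longrightarrow> adj T = S"
  by (rule adj_eqI) (simp_all add: mem_bounded_operators)

lemma adj_adj_M: "T \<in> M \<Longrightarrow> adj (adj T) = T"
  by (rule adj_eqI_M[OF mem_adj]) (simp_all add: inner_commute[of "adj T _"] inner_commute[of _ "T _"] inner_adj_M)

lemma adj_compose_M: "S \<in> M \<Longrightarrow> T \<in> M \<Longrightarrow> adj (S o\<^sub>L T) = adj T o\<^sub>L adj S"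
  by (rule adj_eqI_M) (simp_all add: mem_compose inner_adj_M)

lemma adj_selfadjoint_M: "T \<in> M \<Longrightarrow> selfadjoint T \<Longrightarrow> adj T = T"
  by (simp add: adj_selfadjoint mem_bounded_operators)

lemma selfadjoint_times_adj: "T \<in> M \<Longrightarrow> selfadjoint (T o\<^sub>L adj T)"
  unfolding selfadjoint_def
  by (metis adj_adj_M blinfun_apply_blinfun_compose inner_adj_M mem_adj)

text \<open>Because \<open>\<langle>T T\<^sup>* x, x\<rangle>\<close> is the square of the norm of \<open>T\<^sup>* x\<close>. This replaces a general \<open>T\<close> by a
selfadjoint element with the same closed range.\<close>

lemma times_adj_kernel: "T \<in> M \<Longrightarrow> (T o\<^sub>L adj T) x = 0 \<longleftrightarrow> adj T x = 0"
proof
  assume "T \<in> M" and 0: "(T o\<^sub>L adj T) x = 0"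
  then have "inner (adj T x) (adj T x) = inner (T (adj T x)) x"
    using inner_adj_M[OF \<open>T \<in> M\<close>, of "adj T x" x] by simp
  with 0 show "adj T x = 0" by simp
qed simp

lemma strong_closure_mem:
  assumes E: "E \<in> bounded_operators"
    and approx: "\<And>F \<epsilon>. finite F \<Longrightarrow> \<epsilon> > 0 \<Longrightarrow> \<exists>S\<in>M. \<forall>x\<in>F. norm (S x - E x) < \<epsilon>"
  shows "E \<in> M"
proof (rule ccontr)
  assume "E \<notin> M"
  have "closedin (subtopology strong_operator_topology bounded_operators) M"
    using vn by (simp add: von_neumann_algebra_def)
  then have "openin (subtopology strong_operator_topology bounded_operators) (bounded_operators - M)"
    by (simp add: closedin_def strong_operator_topology_topspace)
  then obtain U where U: "openin strong_operator_topology U"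
    "bounded_operators - M = U \<inter> bounded_operators"
    by (auto simp: openin_subtopology)
  from U(1) obtain W where W: "open W" "U = blinfun_apply -` W"
    unfolding strong_operator_topology_def openin_pullback_topology by auto
  have "blinfun_apply E \<in> W" using E \<open>E \<notin> M\<close> U(2) W(2) by blast
  moreover have "openin (product_topology (\<lambda>_. euclidean) UNIV) W"
    using W(1) by (simp add: open_fun_def)
  ultimately obtain X where X: "blinfun_apply E \<in> (\<Pi>\<^sub>E i\<in>UNIV. X i)" "\<And>i. open (X i)"
    "finite {i. X i \<noteq> UNIV}" "(\<Pi>\<^sub>E i\<in>UNIV. X i) \<subseteq> W"
    using product_topology_open_contains_basis[of "\<lambda>_. euclidean" UNIV W "blinfun_apply E"]
    by (metis open_openin topspace_euclidean)
  have "\<exists>\<epsilon>>0. \<forall>y. norm (y - E i) < \<epsilon> \<longrightarrow> y \<in> X i" for i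
  proof -
    have "E i \<in> X i" using X(1) by (simp add: PiE_iff)
    then obtain \<epsilon> where "\<epsilon> > 0" "ball (E i) \<epsilon> \<subseteq> X i" using openE[OF X(2)] by metis
    then show ?thesis by (auto simp: subset_iff dist_norm norm_minus_commute)
  qed
  then obtain \<epsilon> where \<epsilon>: "\<And>i. \<epsilon> i > 0" "\<And>i y. norm (y - E i) < \<epsilon> i \<Longrightarrow> y \<in> X i" by metis
  define F where "F = {i. X i \<noteq> UNIV}"
  define \<delta> where "\<delta> = Min (insert 1 (\<epsilon> ` F))"
  have "finite F" using X(3) by (simp add: F_def)
  then have "\<delta> > 0" and \<delta>: "\<And>i. i \<in> F \<Longrightarrow> \<delta> \<le> \<epsilon> i" by (auto simp: \<delta>_def \<epsilon>(1))
  from approx[OF \<open>finite F\<close> \<open>\<delta> > 0\<close>] obtain S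
    where S: "S \<in> M" "\<And>x. x \<in> F \<Longrightarrow> norm (S x - E x) < \<delta>" by blast
  have "S i \<in> X i" for i
  proof (cases "i \<in> F")
    case True
    then show ?thesis using \<epsilon>(2) S(2) \<delta> by (meson order_less_le_trans)
  qed (simp add: F_def)
  then have "blinfun_apply S \<in> W" using X(4) by blast
  then show False using S(1) U(2) W(2) mem_bounded_operators by blast
qed

lemma strong_limit_mem:
  assumes E: "E \<in> bounded_operators" and S: "\<And>n. S n \<in> M" and lim: "\<And>x. (\<lambda>n. S n x) \<longlonglongrightarrow> E x"
  shows "E \<in> M"
proof (rule strong_closure_mem[OF E])
  fix F :: "'h set" and \<epsilon> :: real assume "finite F" "\<epsilon> > 0"
  have "\<forall>\<^sub>F n in sequentially. norm (S n x - E x) < \<epsilon>" for x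
    using tendstoD[OF lim \<open>\<epsilon> > 0\<close>] by (simp add: dist_norm)
  then have "\<forall>\<^sub>F n in sequentially. \<forall>x\<in>F. norm (S n x - E x) < \<epsilon>"
    using \<open>finite F\<close> by (simp add: eventually_ball_finite)
  then show "\<exists>S\<in>M. \<forall>x\<in>F. norm (S x - E x) < \<epsilon>"
    using S by (auto simp: eventually_sequentially)
qed

text \<open>Let \<open>P\<close> be the projection onto the closed range of \<open>T\<close> and \<open>B = 1 - T\<^sup>2\<close>. Then \<open>1 - B\<^sup>n\<close> is a
polynomial in \<open>T\<close> without constant term, hence in \<open>M\<close>, and it converges strongly to \<open>P\<close>: on the kernel of \<open>T\<close>,
which is the orthogonal complement of the range, \<open>B\<close> is the identity, and on the range \<open>B\<^sup>n\<close> tends to \<open>0\<close>.\<close>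

lemma range_projection_contraction:
  assumes T: "T \<in> M" and sa: "selfadjoint T" and T1: "norm T \<le> 1"
  obtains P where "P \<in> M" "projection P" "P o\<^sub>L T = T" "\<And>x. T x = 0 \<Longrightarrow> P x = 0"
proof -
  let ?V = "closure (range (blinfun_apply T))"
  have lin: "linear (blinfun_apply T)"
    using blinfun.bounded_linear_right bounded_linear.linear by blast
  have "subspace ?V"
    by (intro subspace_closure linear_subspace_image lin subspace_UNIV)
  moreover have "c *\<^sub>C v \<in> ?V" if "v \<in> ?V" for c v
  proof (rule closure_scaleC[OF _ that])
    fix c v assume "v \<in> range (blinfun_apply T)"
    then obtain u where "v = T u" by blast
    then have "c *\<^sub>C v = T (c *\<^sub>C u)"
      by (simp add: bounded_operatorsD[OF mem_bounded_operators[OF T]])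
    then show "c *\<^sub>C v \<in> range (blinfun_apply T)" by blast
  qed
  ultimately obtain P where P: "P \<in> bounded_operators" "projection P" "\<And>x. P x \<in> ?V"
    "\<And>v. v \<in> ?V \<Longrightarrow> P v = v" "\<And>x. (\<And>w. w \<in> ?V \<Longrightarrow> inner x w = 0) \<Longrightarrow> P x = 0"
    using projection_onto[of ?V] closed_closure by blast
  have PT: "P (T x) = T x" for x using P(4) closure_subset by blast
  have TP: "T (P x) = T x" for x
    using selfadjoint_absorb_commute[OF P(2) sa] PT
    by (metis blinfun_apply_blinfun_compose blinfun_eqI)
  have kerT: "P x = 0" if "T x = 0" for x
  proof (rule P(5))
    fix w assume w: "w \<in> ?V"
    have "range (blinfun_apply T) \<subseteq> {w. inner x w = 0}"
      using that selfadjointD[OF sa, of x] by auto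
    then have "?V \<subseteq> {w. inner x w = 0}"
      by (rule closure_minimal) (intro closed_Collect_eq continuous_intros)
    then show "inner x w = 0" using w by blast
  qed
  define B where "B v = v - T (T v)" for v
  have B_diff: "B (u - v) = B u - B v" for u v
    by (simp add: B_def blinfun.bilinear_simps)
  have Bn_diff: "(B ^^ n) (u - v) = (B ^^ n) u - (B ^^ n) v" for n u v
    by (induction n) (simp_all add: B_diff)
  have Bn_T: "(B ^^ n) (T v) = T ((B ^^ n) v)" for n v
    by (induction n) (simp_all add: B_def blinfun.bilinear_simps)
  have Tle: "norm (T v) \<le> norm v" for v
    using norm_blinfun[of T v] mult_right_mono[OF T1, of "norm v"] by simp
  have B_norm: "(norm (B v))\<^sup>2 \<le> (norm v)\<^sup>2 - (norm (T v))\<^sup>2" for v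
  proof -
    have "(norm (B v))\<^sup>2 = (norm v)\<^sup>2 - 2 * (norm (T v))\<^sup>2 + (norm (T (T v)))\<^sup>2"
      unfolding power2_norm_eq_inner B_def
      by (simp add: inner_simps inner_commute selfadjointD[OF sa, of "T v" v, symmetric]
        selfadjointD[OF sa, of v "T v"])
    moreover have "(norm (T (T v)))\<^sup>2 \<le> (norm (T v))\<^sup>2" using Tle by (simp add: power_mono)
    ultimately show ?thesis by simp
  qed
  have B_le: "norm (B v) \<le> norm v" for v
    using B_norm[of v] by (smt (verit) norm_ge_zero power2_le_imp_le zero_le_power2)
  have Bn_le: "norm ((B ^^ n) v) \<le> norm v" for n v
    by (induction n) (use B_le order_trans in auto)
  \<comment> \<open>\<open>B_norm\<close> bounds the squared norm of \<open>T B\<^sup>n v\<close> by the decrease of that of \<open>B\<^sup>n v\<close> in step \<open>n\<close>,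
    and a bounded decreasing sequence has steps tending to \<open>0\<close>\<close>
  have range_lim: "(\<lambda>n. (B ^^ n) (T v)) \<longlonglongrightarrow> 0" for v
  proof -
    define a where "a n = (norm ((B ^^ n) v))\<^sup>2" for n
    have "decseq a"
      unfolding decseq_Suc_iff a_def using B_le by (simp add: power_mono)
    then obtain l where l: "a \<longlonglongrightarrow> l"
      using decseq_convergent[of a 0] by (auto simp: a_def)
    have "(\<lambda>n. a n - a (Suc n)) \<longlonglongrightarrow> l - l"
      by (intro tendsto_diff l LIMSEQ_Suc)
    then have "(\<lambda>n. a n - a (Suc n)) \<longlonglongrightarrow> 0" by simp
    moreover have "norm ((norm (T ((B ^^ n) v)))\<^sup>2) \<le> a n - a (Suc n)" for n
      using B_norm[of "(B ^^ n) v"] by (simp add: a_def)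
    ultimately have "(\<lambda>n. (norm (T ((B ^^ n) v)))\<^sup>2) \<longlonglongrightarrow> 0"
      by (rule_tac Lim_null_comparison[OF always_eventually]) auto
    then have "(\<lambda>n. sqrt ((norm (T ((B ^^ n) v)))\<^sup>2)) \<longlonglongrightarrow> sqrt 0"
      by (rule tendsto_real_sqrt)
    then show ?thesis by (simp add: Bn_T tendsto_norm_zero_iff)
  qed
  \<comment> \<open>convergence extends to the closure as the \<open>B\<^sup>n\<close> are contractions\<close>
  have V_lim: "(\<lambda>n. (B ^^ n) v) \<longlonglongrightarrow> 0" if v: "v \<in> ?V" for v
  proof (rule LIMSEQ_I)
    fix r :: real assume "0 < r"
    then have "\<exists>w\<in>range (blinfun_apply T). dist w v < r / 2"
      using v unfolding closure_approachable by (meson half_gt_zero)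
    then obtain y where y: "dist (T y) v < r / 2" by blast
    from LIMSEQ_D[OF range_lim[of y], of "r/2"] \<open>0 < r\<close>
    obtain N where N: "\<And>n. n \<ge> N \<Longrightarrow> norm ((B ^^ n) (T y)) < r / 2" by auto
    have "norm ((B ^^ n) v) < r" if "n \<ge> N" for n
    proof -
      have "norm ((B ^^ n) v) \<le> norm ((B ^^ n) (T y)) + norm ((B ^^ n) (T y - v))"
        using norm_triangle_sub[of "(B ^^ n) v" "(B ^^ n) (T y)"]
        by (simp add: Bn_diff norm_minus_commute)
      also have "\<dots> < r" using N[OF that] Bn_le[of n "T y - v"] y by (simp add: dist_norm)
      finally show ?thesis .
    qed
    then show "\<exists>N. \<forall>n\<ge>N. norm ((B ^^ n) v - 0) < r" by auto
  qed
  have "\<exists>S\<in>M. \<forall>v. S v = v - (B ^^ n) v" for n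
  proof (induction n)
    case 0
    show ?case by (rule bexI[OF _ mem_0]) simp
  next
    case (Suc n)
    then obtain S where S: "S \<in> M" "\<And>v. S v = v - (B ^^ n) v" by blast
    \<comment> \<open>from \<open>1 - B\<^sup>n\<^sup>+\<^sup>1 = 1 - (1 - T\<^sup>2) (1 - S)\<close> for \<open>S = 1 - B\<^sup>n\<close>; the identity operator
      may lie outside \<open>M\<close> and cancels\<close>
    let ?S = "S + (T o\<^sub>L T) - (T o\<^sub>L T o\<^sub>L S)"
    have "?S \<in> M" using S(1) T by (intro mem_add mem_diff mem_compose)
    moreover have "?S v = v - (B ^^ Suc n) v" for v
      by (simp add: blinfun.bilinear_simps S(2) B_def)
    ultimately show ?case by blast
  qed
  then obtain S where S: "\<And>n. S n \<in> M" "\<And>n v. S n v = v - (B ^^ n) v" by metis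
  have PM: "P \<in> M"
  proof (rule strong_limit_mem[OF P(1) S(1)])
    fix x
    have ker: "T (x - P x) = 0" by (simp add: blinfun.bilinear_simps TP)
    have "(B ^^ n) (x - P x) = x - P x" for n
      by (induction n) (simp_all add: B_def ker)
    then have "S n x = P x - (B ^^ n) (P x)" for n
      by (simp add: S(2) Bn_diff algebra_simps) 
    moreover have "(\<lambda>n. P x - (B ^^ n) (P x)) \<longlonglongrightarrow> P x - 0"
      by (intro tendsto_intros V_lim P(3))
    ultimately show "(\<lambda>n. S n x) \<longlonglongrightarrow> P x" by simp
  qed
  have "P o\<^sub>L T = T" by (rule blinfun_eqI) (simp add: PT)
  then show ?thesis by (rule that[OF PM P(2) _ kerT])
qed

lemma range_projection:
  assumes T: "T \<in> M" and sa: "selfadjoint T"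
  obtains P where "P \<in> M" "projection P" "P o\<^sub>L T = T" "\<And>x. T x = 0 \<Longrightarrow> P x = 0"
proof -
  define k where "k = inverse (1 + norm T)"
  have k: "k > 0" by (simp add: k_def add_pos_nonneg)
  have "norm (k *\<^sub>R T) \<le> 1" using k by (simp add: k_def field_simps)
  then obtain P where P: "P \<in> M" "projection P" "P o\<^sub>L (k *\<^sub>R T) = k *\<^sub>R T"
    "\<And>x. (k *\<^sub>R T) x = 0 \<Longrightarrow> P x = 0"
    using range_projection_contraction[of "k *\<^sub>R T"] mem_scaleR[OF T] selfadjoint_scaleR[OF sa]
    by metis
  have "k *\<^sub>R (P o\<^sub>L T) = k *\<^sub>R T"
    using P(3) by (metis bounded_bilinear.scaleR_right bounded_bilinear_blinfun_compose)
  then have "P o\<^sub>L T = T" using k by simp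
  then show ?thesis using P by (intro that[of P]) (auto simp: blinfun.bilinear_simps)
qed

text \<open>The ranges of a directed family form a subspace \<open>R\<close>, and \<open>E\<close> projects onto its closure. Near
finitely many vectors \<open>E x\<close> there are vectors fixed by a single \<open>p\<close> of the family, so \<open>p\<close> approximates \<open>E\<close> at all
these \<open>x\<close> and \<open>E\<close> lies in the strong closure of the family.\<close>

lemma sup_projection:
  assumes D: "D \<subseteq> M" "D \<noteq> {}" "\<And>p. p \<in> D \<Longrightarrow> projection p"
    and dir: "\<And>p q. p \<in> D \<Longrightarrow> q \<in> D \<Longrightarrow> \<exists>r\<in>D. r o\<^sub>L p = p \<and> r o\<^sub>L q = q"
  obtains E where "E \<in> M" "projection E" "\<And>p. p \<in> D \<Longrightarrow> E o\<^sub>L p = p"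
    "\<And>x. (\<And>p. p \<in> D \<Longrightarrow> p x = 0) \<Longrightarrow> E x = 0"
proof -
  define R where "R = (\<Union>p\<in>D. range (blinfun_apply p))"
  have fixR: "\<exists>p\<in>D. p v = v" if "v \<in> R" for v
    using that D(3) projection_idem by (fastforce simp: R_def)
  have common: "\<exists>r\<in>D. \<forall>x\<in>F. r x = x" if "finite F" "F \<subseteq> R" for F
    using that
  proof (induction F)
    case empty
    then show ?case using D(2) by blast
  next
    case (insert v F)
    then obtain r where r: "r \<in> D" "\<forall>x\<in>F. r x = x" by auto
    from fixR insert.prems obtain p where p: "p \<in> D" "p v = v" by auto
    from dir[OF p(1) r(1)] obtain q where q: "q \<in> D" "q o\<^sub>L p = p" "q o\<^sub>L r = r" by blast
    have "q v = v" using p(2) q(2) by (metis blinfun_apply_blinfun_compose)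
    moreover have "q x = x" if "x \<in> F" for x
      using r(2) q(3) that by (metis blinfun_apply_blinfun_compose)
    ultimately show ?case using q(1) by auto
  qed
  have memR: "v \<in> R" if "p \<in> D" "p v = v" for p v
    using that unfolding R_def by (metis UN_I rangeI)
  have "subspace R"
  proof (rule subspaceI)
    show "0 \<in> R" using D(2) memR blinfun.zero_right by blast
    show "x + y \<in> R" if "x \<in> R" "y \<in> R" for x y
      using common[of "{x, y}"] that memR by (auto simp: blinfun.add_right)
    show "c *\<^sub>R x \<in> R" if "x \<in> R" for c x
      using fixR[OF that] memR by (auto simp: blinfun.scaleR_right)
  qed
  then have "subspace (closure R)" by (rule subspace_closure)
  moreover have "c *\<^sub>C v \<in> closure R" if "v \<in> closure R" for c v
  proof (rule closure_scaleC[OF _ that])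
    fix c x assume "x \<in> R"
    from fixR[OF this] obtain p where p: "p \<in> D" "p x = x" by blast
    then have "p (c *\<^sub>C x) = c *\<^sub>C x"
      using D(1) bounded_operatorsD[OF mem_bounded_operators, of p] by auto
    then show "c *\<^sub>C x \<in> R" using p(1) memR by blast
  qed
  ultimately obtain E where E: "E \<in> bounded_operators" "projection E" "\<And>x. E x \<in> closure R"
    "\<And>v. v \<in> closure R \<Longrightarrow> E v = v" "\<And>x. (\<And>w. w \<in> closure R \<Longrightarrow> inner x w = 0) \<Longrightarrow> E x = 0"
    using projection_onto[of "closure R"] closed_closure by blast
  have Ep: "E o\<^sub>L p = p" if "p \<in> D" for p
  proof (rule blinfun_eqI)
    have "p x \<in> R" for x using that by (auto simp: R_def)
    then show "(E o\<^sub>L p) x = p x" for x using E(4) closure_subset by auto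
  qed
  have pE: "p (E x) = p x" if "p \<in> D" for p x
    using Ep[OF that] projection_absorb_commute[OF E(2) D(3)[OF that]] 
    by (metis blinfun_apply_blinfun_compose)
  have EM: "E \<in> M"
  proof (rule strong_closure_mem[OF E(1)])
    fix F :: "'h set" and \<epsilon> :: real assume F: "finite F" and \<epsilon>: "\<epsilon> > 0"
    have "\<exists>y\<in>R. dist y (E x) < \<epsilon> / 2" for x
      using E(3)[of x] half_gt_zero[OF \<epsilon>] unfolding closure_approachable by blast
    then obtain y where y: "\<And>x. y x \<in> R" "\<And>x. dist (y x) (E x) < \<epsilon> / 2" by metis
    obtain p where p: "p \<in> D" "\<forall>x\<in>y ` F. p x = x"
      using common[of "y ` F"] F y(1) by blast
    have "norm (p x - E x) < \<epsilon>" if "x \<in> F" for x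
    proof -
      have "p x - E x = p (E x - y x) + (y x - E x)"
        using p that by (simp add: blinfun.bilinear_simps pE)
      also have "norm \<dots> \<le> norm (E x - y x) + norm (y x - E x)"
        using norm_triangle_ineq projection_norm_le[OF D(3)[OF p(1)]]
        by (meson add_right_mono order_trans)
      also have "\<dots> < \<epsilon>" using y(2)[of x] by (simp add: dist_norm norm_minus_commute)
      finally show ?thesis .
    qed
    then show "\<exists>S\<in>M. \<forall>x\<in>F. norm (S x - E x) < \<epsilon>" using p(1) D(1) by blast
  qed
  have E0: "E x = 0" if "\<And>p. p \<in> D \<Longrightarrow> p x = 0" for x
  proof (rule E(5))
    fix w assume w: "w \<in> closure R"
    have "R \<subseteq> {w. inner x w = 0}"
      unfolding R_def using that D(3) projection_inner by (force simp flip: projection_inner)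
    then have "closure R \<subseteq> {w. inner x w = 0}"
      by (rule closure_minimal) (intro closed_Collect_eq continuous_intros)
    then show "inner x w = 0" using w by blast
  qed
  show ?thesis by (rule that[OF EM E(2) Ep E0])
qed

text \<open>The projections of \<open>M\<close> are directed, since the range projection of \<open>p + q\<close> lies above \<open>p\<close> and \<open>q\<close>.
Their supremum \<open>e\<close> fixes the range of every \<open>T\<close> because it lies above the range projection of \<open>T T\<^sup>*\<close>; the
other side follows by adjoints.\<close>

lemma unit_exists:
  obtains e where "is_unit_of M e" "projection e"
proof -
  define D where "D = {p \<in> M. projection p}"
  have dir: "\<exists>r\<in>D. r o\<^sub>L p = p \<and> r o\<^sub>L q = q" if pq: "p \<in> D" "q \<in> D" for p q
  proof -
    have pq': "p \<in> M" "q \<in> M" "projection p" "projection q" using pq by (auto simp: D_def)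
    then have "selfadjoint (p + q)" by (auto intro: selfadjoint_add simp: projection_def)
    obtain r where r: "r \<in> M" "projection r" "r o\<^sub>L (p + q) = p + q"
      using range_projection[OF mem_add[OF pq'(1,2)] \<open>selfadjoint (p + q)\<close>] by blast
    have rs: "(p + q) o\<^sub>L r = p + q"
      by (rule selfadjoint_absorb_commute) (use r \<open>selfadjoint (p + q)\<close> in auto)
    have "p (x - r x) = 0 \<and> q (x - r x) = 0" for x
    proof -
      let ?u = "x - r x"
      have "(p + q) ?u = 0"
        using arg_cong[OF rs, of "\<lambda>T. blinfun_apply T x"] by (simp add: blinfun.bilinear_simps)
      then have "inner ((p + q) ?u) ?u = 0" by simp
      then have "(norm (p ?u))\<^sup>2 + (norm (q ?u))\<^sup>2 = 0"
        by (simp only: blinfun.add_left inner_add_left projection_inner_self pq')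
      then show ?thesis by (simp add: add_nonneg_eq_0_iff)
    qed
    then have "p o\<^sub>L r = p" "q o\<^sub>L r = q"
      by (auto intro!: blinfun_eqI simp: blinfun.diff_right)
    then have "r o\<^sub>L p = p" "r o\<^sub>L q = q"
      using projection_absorb_commute[of r p] projection_absorb_commute[of r q] pq' r(2) by simp_all
    then show ?thesis using r by (auto simp: D_def)
  qed
  have "0 \<in> D"
    using mem_0 by (auto simp: D_def projection_def selfadjoint_def)
  then have ne: "D \<noteq> {}" by blast
  have DM: "D \<subseteq> M" and proj: "\<And>p. p \<in> D \<Longrightarrow> projection p" by (auto simp: D_def)
  have "\<exists>e\<in>M. projection e \<and> (\<forall>p\<in>D. e o\<^sub>L p = p)"
    by (rule sup_projection[OF DM ne proj dir]) auto
  then obtain e where e: "e \<in> M" "projection e" "\<And>p. p \<in> D \<Longrightarrow> e o\<^sub>L p = p"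
    by blast
  have left: "e o\<^sub>L T = T" if T: "T \<in> M" for T
  proof -
    have "T o\<^sub>L adj T \<in> M" by (intro mem_compose mem_adj T)
    then obtain P where P: "P \<in> M" "projection P" "P o\<^sub>L (T o\<^sub>L adj T) = T o\<^sub>L adj T"
      using range_projection[OF _ selfadjoint_times_adj[OF T]] by blast
    have TTP: "(T o\<^sub>L adj T) o\<^sub>L P = T o\<^sub>L adj T"
      by (rule selfadjoint_absorb_commute) (use P selfadjoint_times_adj[OF T] in auto)
    have "(T o\<^sub>L adj T) (x - P x) = 0" for x
      unfolding blinfun.diff_right using compose_eqD[OF TTP, of x] by simp
    then have 1: "adj T (P x) = adj T x" for x
      using times_adj_kernel[OF T, of "x - P x"] unfolding blinfun.diff_right by simp
    have PT: "P (T x) = T x" for x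
    proof (rule inner_eq_all_imp_eq)
      fix y
      have "inner y (P (T x)) = inner (T x) (P y)"
        by (subst inner_commute) (simp add: projection_inner[OF P(2)])
      also have "\<dots> = inner y (T x)" by (simp add: inner_adj_M[OF T] 1 inner_commute[of y])
      finally show "inner y (P (T x)) = inner y (T x)" .
    qed
    have "e (P y) = P y" for y
      using compose_eqD[OF e(3)] P(1,2) by (simp add: D_def)
    then show ?thesis by (intro blinfun_eqI) (metis PT blinfun_apply_blinfun_compose)
  qed
  have right: "T o\<^sub>L e = T" if T: "T \<in> M" for T
  proof (rule blinfun_eqI, rule inner_eq_all_imp_eq)
    fix x y
    have "inner y ((T o\<^sub>L e) x) = inner (e (adj T y)) x"
      using T by (simp add: projection_inner[OF e(2)] inner_adj_M mem_adj adj_adj_M)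
    also have "e (adj T y) = adj T y"
      using left[OF mem_adj[OF T]] by (metis blinfun_apply_blinfun_compose)
    finally show "inner y ((T o\<^sub>L e) x) = inner y (T x)"
      using T by (simp add: inner_adj_M mem_adj adj_adj_M)
  qed
  show ?thesis using e left right by (intro that[of e]) (auto simp: is_unit_of_def)
qed

section \<open>Absolute values\<close>

lemma norm_limit_mem:
  assumes "\<And>n. Y n \<in> M" "Y \<longlonglongrightarrow> Z"
  shows "Z \<in> M"
  using closed_sequentially[OF closed_M] assms by blast

lemma complementary_square_norm:
  assumes p: "projection p" and T: "selfadjoint T" "p o\<^sub>L T = T" "norm T \<le> 1"
  shows "norm (p - (T o\<^sub>L T)) \<le> 1"
proof (rule norm_blinfun_bound)
  fix v
  let ?X = "p - (T o\<^sub>L T)"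
  have "inner (p v) (T (T v)) = inner v (T (T v))"
    by (simp add: projection_inner[OF p] compose_eqD[OF T(2)])
  also have "\<dots> = (norm (T v))\<^sup>2"
    by (simp add: power2_norm_eq_inner selfadjointD[OF T(1)])
  finally have "inner (p v) (T (T v)) = (norm (T v))\<^sup>2" .
  moreover have "norm (T (T v)) \<le> norm (T v)"
    using norm_blinfun[of T "T v"] mult_right_mono[OF T(3), of "norm (T v)"] by simp
  then have "(norm (T (T v)))\<^sup>2 \<le> (norm (T v))\<^sup>2" by (simp add: power_mono)
  moreover have "(norm (?X v))\<^sup>2 = (norm (p v))\<^sup>2 - 2 * inner (p v) (T (T v)) + (norm (T (T v)))\<^sup>2"
    unfolding power2_norm_eq_inner blinfun.diff_left
    by (simp add: inner_diff_left inner_diff_right inner_commute[of "T (T v)" "p v"])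
  ultimately have "(norm (?X v))\<^sup>2 \<le> (norm (p v))\<^sup>2"
    using zero_le_power2[of "norm (T v)"] by linarith
  then show "norm (?X v) \<le> 1 * norm v"
    using projection_norm_le[OF p, of v] power2_le_imp_le[of "norm (?X v)" "norm (p v)"] by simp
qed simp

text \<open>Since \<open>T\<^sup>2 = p - X\<close> for the contraction \<open>X = p - T\<^sup>2\<close>, the absolute value is \<open>A = p - Z\<close> for
a solution \<open>Z\<close> of \<open>Z = (X + Z\<^sup>2) / 2\<close>. The iteration \<open>Y\<close> for this equation converges in norm because its
steps are bounded by those of the iteration \<open>y\<close> for the real equation \<open>z = (1 + z\<^sup>2) / 2\<close>, which increases and stays
below \<open>1\<close>. As \<open>Z\<close> is a contraction that commutes with \<open>p\<close>, \<open>A\<close> is positive.\<close>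

lemma absolute_value:
  assumes p: "p \<in> M" "projection p" and T: "T \<in> M" "selfadjoint T" "p o\<^sub>L T = T" "norm T \<le> 1"
  obtains A where "A \<in> M" "selfadjoint A" "p o\<^sub>L A = A" "A o\<^sub>L A = T o\<^sub>L T" "A o\<^sub>L T = T o\<^sub>L A"
    "\<And>x. inner (A x) x \<ge> 0"
proof -
  define X where "X = p - (T o\<^sub>L T)"
  have XM: "X \<in> M" unfolding X_def by (intro mem_diff mem_compose p T)
  have Xsa: "selfadjoint X"
    unfolding X_def using p(2) by (intro selfadjoint_diff selfadjoint_square T) (simp add: projection_def)
  have X1: "norm X \<le> 1" unfolding X_def by (rule complementary_square_norm[OF p(2) T(2-4)])
  have Tp: "T (p x) = T x" and pT: "p (T x) = T x" for x
    using compose_eqD[OF T(3)] compose_eqD[OF selfadjoint_absorb_commute[OF p(2) T(2,3)]] by auto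
  have pX: "p (X x) = X x" for x
    by (simp add: X_def blinfun.diff_left blinfun.diff_right projection_idem[OF p(2)] pT)
  have XT: "X (T x) = T (X x)" for x
    by (simp add: X_def blinfun.diff_left blinfun.diff_right Tp pT)
  define Y where "Y = rec_nat (0 :: 'h \<Rightarrow>\<^sub>L 'h) (\<lambda>_ Y. (1/2) *\<^sub>R (X + (Y o\<^sub>L Y)))"
  define y where "y = rec_nat (0 :: real) (\<lambda>_ y. (1 + y * y) / 2)"
  have Y0: "Y 0 = 0" and YS: "Y (Suc n) = (1/2) *\<^sub>R (X + (Y n o\<^sub>L Y n))" for n by (simp_all add: Y_def)
  have y0: "y 0 = 0" and yS: "y (Suc n) = (1 + y n * y n) / 2" for n by (simp_all add: y_def)
  have YM: "Y n \<in> M" for n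
    by (induction n) (simp_all add: Y0 YS mem_0 mem_scaleR mem_add mem_compose XM)
  have Ysa: "selfadjoint (Y n)" for n
    by (induction n) (simp_all add: Y0 YS selfadjoint_scaleR selfadjoint_add selfadjoint_square Xsa,
      simp add: selfadjoint_def)
  have pY: "p (Y n x) = Y n x" for n x
    by (induction n arbitrary: x)
      (simp_all add: Y0 YS blinfun.add_left blinfun.add_right blinfun.scaleR_left blinfun.scaleR_right pX)
  have YT: "Y n (T x) = T (Y n x)" for n x
    by (induction n arbitrary: x)
      (simp_all add: Y0 YS blinfun.add_left blinfun.add_right blinfun.scaleR_left blinfun.scaleR_right XT)
  have y01: "0 \<le> y n \<and> y n \<le> 1" for n
    by (induction n) (auto simp: y0 yS mult_le_one)
  have Yle: "norm (Y n) \<le> y n" for n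
  proof (induction n)
    case (Suc n)
    have "norm (X + (Y n o\<^sub>L Y n)) \<le> norm X + norm (Y n) * norm (Y n)"
      by (rule order_trans[OF norm_triangle_ineq add_left_mono[OF norm_blinfun_compose]])
    also have "\<dots> \<le> 1 + y n * y n"
      using Suc y01[of n] X1 by (intro add_mono mult_mono) auto
    finally show ?case by (simp add: YS yS)
  qed (simp add: Y0 y0)
  \<comment> \<open>\<open>2 (Y\<^sub>n\<^sub>+\<^sub>2 - Y\<^sub>n\<^sub>+\<^sub>1) = Y\<^sub>n\<^sub>+\<^sub>1 D + D Y\<^sub>n\<close> for \<open>D = Y\<^sub>n\<^sub>+\<^sub>1 - Y\<^sub>n\<close>,
    and likewise for \<open>y\<close>\<close>
  have step: "norm (Y (Suc n) - Y n) \<le> y (Suc n) - y n" for n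
  proof (induction n)
    case 0
    show ?case using X1 by (simp add: YS yS Y0 y0)
  next
    case (Suc n)
    define D where "D = Y (Suc n) - Y n"
    have "Y (Suc (Suc n)) - Y (Suc n)
        = (1/2) *\<^sub>R (X + (Y (Suc n) o\<^sub>L Y (Suc n))) - (1/2) *\<^sub>R (X + (Y n o\<^sub>L Y n))"
      by (rule arg_cong2[where f = minus, OF YS YS])
    also have "\<dots> = (1/2) *\<^sub>R ((Y (Suc n) o\<^sub>L D) + (D o\<^sub>L Y n))"
      by (rule blinfun_eqI)
        (simp add: D_def blinfun.add_left blinfun.diff_left blinfun.scaleR_left blinfun.diff_right
          algebra_simps)
    finally have "norm (Y (Suc (Suc n)) - Y (Suc n)) \<le> (1/2) * (norm (Y (Suc n)) * norm D + norm D * norm (Y n))"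
      by (simp add: order_trans[OF norm_triangle_ineq add_mono[OF norm_blinfun_compose norm_blinfun_compose]])
    also have "\<dots> \<le> (1/2) * (y (Suc n) * (y (Suc n) - y n) + (y (Suc n) - y n) * y n)"
      using Suc order_trans[OF norm_ge_zero Suc] Yle[of n] Yle[of "Suc n"] y01[of n] y01[of "Suc n"]
      unfolding D_def by (intro mult_left_mono add_mono mult_mono) auto
    also have "\<dots> = (1 + y (Suc n) * y (Suc n)) / 2 - (1 + y n * y n) / 2"
      by (simp add: field_simps)
    also have "\<dots> = y (Suc (Suc n)) - y (Suc n)"
      by (rule arg_cong2[where f = minus, OF yS yS, symmetric])
    finally show ?case .
  qed
  have "incseq y"
    unfolding incseq_Suc_iff
  proof
    show "y n \<le> y (Suc n)" for n using order_trans[OF norm_ge_zero step[of n]] by simp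
  qed
  moreover have "\<forall>n. y n \<le> 1" using y01 by simp
  ultimately obtain l where "y \<longlonglongrightarrow> l"
    by (rule incseq_convergent)
  then have "summable (\<lambda>n. y (Suc n) - y n)" by (rule telescope_summable)
  then have "summable (\<lambda>n. Y (Suc n) - Y n)"
    by (rule summable_comparison_test'[of _ 0]) (rule step)
  define Z where "Z = (\<Sum>k. Y (Suc k) - Y k)"
  have "(\<lambda>n. \<Sum>k<n. Y (Suc k) - Y k) \<longlonglongrightarrow> Z"
    unfolding Z_def by (rule summable_LIMSEQ) fact
  then have Z: "Y \<longlonglongrightarrow> Z"
    by (simp add: sum_lessThan_telescope Y0)
  have Zx: "(\<lambda>n. Y n x) \<longlonglongrightarrow> Z x" for x
    by (rule bounded_linear.tendsto[OF bounded_linear_apply_blinfun Z])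
  have ZM: "Z \<in> M" by (rule norm_limit_mem[OF YM Z])
  have Z1: "norm Z \<le> 1"
  proof (rule LIMSEQ_le_const2[OF tendsto_norm[OF Z]])
    show "\<exists>N. \<forall>n\<ge>N. norm (Y n) \<le> 1"
      using order_trans[OF Yle] y01 by simp
  qed
  have Zsa: "selfadjoint Z"
    unfolding selfadjoint_def
  proof (intro allI)
    fix u v
    have "(\<lambda>n. inner (Y n u) v) \<longlonglongrightarrow> inner (Z u) v" "(\<lambda>n. inner u (Y n v)) \<longlonglongrightarrow> inner u (Z v)"
      by (intro tendsto_intros Zx)+
    then show "inner (Z u) v = inner u (Z v)"
      unfolding selfadjointD[OF Ysa] by (rule LIMSEQ_unique)
  qed
  have pZ: "p (Z x) = Z x" for x
  proof (rule LIMSEQ_unique[OF _ Zx])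
    have "(\<lambda>n. p (Y n x)) \<longlonglongrightarrow> p (Z x)"
      by (rule bounded_linear.tendsto[OF blinfun.bounded_linear_right Zx])
    then show "(\<lambda>n. Y n x) \<longlonglongrightarrow> p (Z x)" by (simp only: pY)
  qed
  have ZT: "Z (T x) = T (Z x)" for x
  proof (rule LIMSEQ_unique[OF Zx])
    have "(\<lambda>n. T (Y n x)) \<longlonglongrightarrow> T (Z x)"
      by (rule bounded_linear.tendsto[OF blinfun.bounded_linear_right Zx])
    then show "(\<lambda>n. Y n (T x)) \<longlonglongrightarrow> T (Z x)" by (simp only: YT)
  qed
  have Zeq: "Z = (1/2) *\<^sub>R (X + (Z o\<^sub>L Z))"
  proof (rule LIMSEQ_unique[OF LIMSEQ_Suc[OF Z]])
    have "(\<lambda>n. (1/2) *\<^sub>R (X + (Y n o\<^sub>L Y n))) \<longlonglongrightarrow> (1/2) *\<^sub>R (X + (Z o\<^sub>L Z))"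
      by (intro tendsto_intros Z bounded_bilinear.tendsto[OF bounded_bilinear_blinfun_compose])
    then show "(\<lambda>n. Y (Suc n)) \<longlonglongrightarrow> (1/2) *\<^sub>R (X + (Z o\<^sub>L Z))" by (simp only: YS)
  qed
  have Zp: "Z (p x) = Z x" for x
    using compose_eqD[OF selfadjoint_absorb_commute[OF p(2) Zsa]] pZ by (simp add: blinfun_eqI)
  have ZZ: "Z (Z x) = 2 *\<^sub>R Z x - X x" for x
  proof -
    have "2 *\<^sub>R Z x = X x + Z (Z x)"
      using arg_cong[OF Zeq, of "\<lambda>S. 2 *\<^sub>R blinfun_apply S x"]
      by (simp add: blinfun.add_left blinfun.scaleR_left)
    then show ?thesis by simp
  qed
  define A where "A = p - Z"
  show ?thesis
  proof (rule that[of A])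
    show "A \<in> M" unfolding A_def by (intro mem_diff p ZM)
    show "selfadjoint A" unfolding A_def using p(2) by (intro selfadjoint_diff Zsa) (simp add: projection_def)
    show "p o\<^sub>L A = A"
      by (rule blinfun_eqI) (simp add: A_def blinfun.diff_left blinfun.diff_right pZ projection_idem[OF p(2)])
    show "A o\<^sub>L A = T o\<^sub>L T"
      by (rule blinfun_eqI)
        (simp add: A_def blinfun.diff_left blinfun.diff_right pZ Zp projection_idem[OF p(2)] ZZ X_def
          scaleR_2)
    show "A o\<^sub>L T = T o\<^sub>L A"
      by (rule blinfun_eqI) (simp add: A_def blinfun.diff_left blinfun.diff_right pT Tp ZT)
    show "inner (A x) x \<ge> 0" for x
    proof -
      have "inner (Z x) x = inner (Z (p x)) (p x)"
        using projection_inner[OF p(2), of "Z x" x] by (simp add: Zp pZ)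
      also have "\<dots> \<le> norm (Z (p x)) * norm (p x)" by (rule norm_cauchy_schwarz)
      also have "\<dots> \<le> (norm (p x))\<^sup>2"
        using norm_blinfun[of Z "p x"] mult_right_mono[OF Z1, of "norm (p x)"]
        by (simp add: power2_eq_square mult_right_mono)
      finally show ?thesis
        by (simp add: A_def blinfun.diff_left inner_diff_left projection_inner_self[OF p(2)])
    qed
  qed
qed

section \<open>Minimal projections\<close>

definition minimal :: "('h \<Rightarrow>\<^sub>L 'h) \<Rightarrow> bool"
  where "minimal p \<longleftrightarrow> p \<in> M \<and> projection p \<and> p \<noteq> 0 \<and>
    (\<forall>q\<in>M. projection q \<longrightarrow> p o\<^sub>L q = q \<longrightarrow> q = 0 \<or> q = p)"

text \<open>The range projection of \<open>C\<close> is nonzero and below \<open>p\<close>, so it equals \<open>p\<close>, and \<open>C\<close> is injective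
on the range of \<open>p\<close>.\<close>

lemma minimal_no_zero_divisors:
  fixes D :: "'h \<Rightarrow>\<^sub>L 'h"
  assumes p: "minimal p" and C: "C \<in> M" "selfadjoint C" "p o\<^sub>L C = C" "C \<noteq> 0"
    and D: "p o\<^sub>L D = D" "C o\<^sub>L D = 0"
  shows "D = 0"
proof -
  have pp: "p \<in> M" "projection p" using p by (auto simp: minimal_def)
  obtain q where q: "q \<in> M" "projection q" "q o\<^sub>L C = C" "\<And>x. C x = 0 \<Longrightarrow> q x = 0"
    using range_projection[OF C(1,2)] by metis
  have Cp: "C (p x) = C x" for x
    using compose_eqD[OF selfadjoint_absorb_commute[OF pp(2) C(2,3)]] .
  have "q o\<^sub>L p = q"
  proof (rule blinfun_eqI)
    fix x
    have "C (x - p x) = 0" by (simp add: blinfun.diff_right Cp)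
    then show "(q o\<^sub>L p) x = q x" using q(4)[of "x - p x"] by (simp add: blinfun.diff_right)
  qed
  then have "p o\<^sub>L q = q" using projection_absorb_commute[OF pp(2) q(2)] by simp
  moreover have "q \<noteq> 0" using q(3) C(4) by auto
  ultimately have "q = p" using p q(1,2) by (auto simp: minimal_def)
  show "D = 0"
  proof (rule blinfun_eqI)
    fix x
    have "C (D x) = 0" using compose_eqD[OF D(2)] by simp
    then have "p (D x) = 0" using q(4) \<open>q = p\<close> by blast
    then show "D x = (0 :: 'h \<Rightarrow>\<^sub>L 'h) x" using compose_eqD[OF D(1), of x] by simp
  qed
qed

text \<open>With \<open>A\<close> the absolute value of \<open>T\<close>, the product \<open>(A + T) (A - T) = A\<^sup>2 - T\<^sup>2\<close> vanishes, so one of the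
factors does. Scaling by \<open>k\<close> makes \<open>T\<close> a contraction.\<close>

lemma minimal_semidefinite:
  assumes p: "minimal p" and T: "T \<in> M" "selfadjoint T" "p o\<^sub>L T = T"
  shows "(\<forall>x. inner (T x) x \<ge> 0) \<or> (\<forall>x. inner (T x) x \<le> 0)"
proof -
  have pp: "p \<in> M" "projection p" using p by (auto simp: minimal_def)
  define k where "k = inverse (1 + norm T)"
  have k: "k > 0" by (simp add: k_def add_pos_nonneg)
  define S where "S = k *\<^sub>R T"
  have Sx: "S x = k *\<^sub>R T x" for x by (simp add: S_def blinfun.scaleR_left)
  have S1: "norm S \<le> 1" using k by (simp add: S_def k_def field_simps)
  have SM: "S \<in> M" and Ssa: "selfadjoint S" unfolding S_def by (intro mem_scaleR selfadjoint_scaleR T)+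
  have pS: "p o\<^sub>L S = S"
    by (rule blinfun_eqI) (simp add: Sx blinfun.scaleR_right compose_eqD[OF T(3)])
  obtain A where A: "A \<in> M" "selfadjoint A" "p o\<^sub>L A = A" "A o\<^sub>L A = S o\<^sub>L S" "A o\<^sub>L S = S o\<^sub>L A"
    "\<And>x. inner (A x) x \<ge> 0"
    using absolute_value[OF pp SM Ssa pS S1] by metis
  have "(A + S) o\<^sub>L (A - S) = 0"
    by (rule blinfun_eqI)
      (simp add: blinfun.add_left blinfun.diff_left blinfun.diff_right blinfun.add_right
        compose_eqD[OF A(4)] compose_eqD[OF A(5)])
  moreover have "p o\<^sub>L (A + S) = A + S" "p o\<^sub>L (A - S) = A - S"
    by (rule blinfun_eqI, simp add: blinfun.add_left blinfun.diff_left blinfun.diff_right blinfun.add_right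
        compose_eqD[OF A(3)] compose_eqD[OF pS])+
  ultimately have "A + S = 0 \<or> A - S = 0"
    using minimal_no_zero_divisors[OF p mem_add[OF A(1) SM] selfadjoint_add[OF A(2) Ssa]] by blast
  then show ?thesis
  proof
    assume "A - S = 0"
    then have "inner (S x) x \<ge> 0" for x using A(6) by simp
    then show ?thesis using k by (simp add: Sx zero_le_mult_iff)
  next
    assume "A + S = 0"
    then have "S = - A" by (simp add: eq_neg_iff_add_eq_0 add.commute)
    then have "inner (S x) x \<le> 0" for x using A(6)[of x] by (simp add: blinfun.minus_left)
    then show ?thesis using k by (simp add: Sx mult_le_0_iff)
  qed
qed

text \<open>Every \<open>T - s p\<close> is semidefinite. If \<open>r\<close> is the value of the form of \<open>T\<close> at a unit vector in the
range of \<open>p\<close>, then \<open>T \<ge> s p\<close> for \<open>s < r\<close> and \<open>T \<le> s p\<close> for \<open>s > r\<close>; in the limit both hold for \<open>r\<close>.\<close>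

lemma minimal_selfadjoint_scalar:
  assumes p: "minimal p" and T: "T \<in> M" "selfadjoint T" "p o\<^sub>L T = T"
  obtains r where "T = r *\<^sub>R p"
proof -
  have pp: "p \<in> M" "projection p" "p \<noteq> 0" using p by (auto simp: minimal_def)
  then obtain w where w: "p w \<noteq> 0" by (metis blinfun_eqI zero_blinfun.rep_eq)
  define r where "r = inner (T w) w / (norm (p w))\<^sup>2"
  have sd: "(\<forall>x. inner (T x) x \<ge> s * (norm (p x))\<^sup>2) \<or> (\<forall>x. inner (T x) x \<le> s * (norm (p x))\<^sup>2)" for s
  proof -
    have "T - s *\<^sub>R p \<in> M" by (intro mem_diff mem_scaleR T pp)
    moreover have "selfadjoint (T - s *\<^sub>R p)"
      using pp(2) by (intro selfadjoint_diff selfadjoint_scaleR T) (simp add: projection_def)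
    moreover have "p o\<^sub>L (T - s *\<^sub>R p) = T - s *\<^sub>R p"
      by (rule blinfun_eqI)
        (simp add: blinfun.diff_left blinfun.diff_right blinfun.scaleR_left blinfun.scaleR_right
          compose_eqD[OF T(3)] projection_idem[OF pp(2)])
    ultimately have "(\<forall>x. inner ((T - s *\<^sub>R p) x) x \<ge> 0) \<or> (\<forall>x. inner ((T - s *\<^sub>R p) x) x \<le> 0)"
      by (rule minimal_semidefinite[OF p])
    then show ?thesis
      by (simp add: blinfun.diff_left blinfun.scaleR_left inner_diff_left projection_inner_self[OF pp(2)])
  qed
  have Tw: "inner (T w) w = r * (norm (p w))\<^sup>2" using w by (simp add: r_def)
  have pos: "(norm (p w))\<^sup>2 > 0" using w by simp
  have low: "s * (norm (p x))\<^sup>2 \<le> inner (T x) x" if "s < r" for s x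
  proof -
    have "\<not> inner (T w) w \<le> s * (norm (p w))\<^sup>2" using that pos unfolding Tw by simp
    then show ?thesis using sd[of s] by blast
  qed
  have up: "inner (T x) x \<le> s * (norm (p x))\<^sup>2" if "s > r" for s x
  proof -
    have "\<not> s * (norm (p w))\<^sup>2 \<le> inner (T w) w" using that pos unfolding Tw by simp
    then show ?thesis using sd[of s] by blast
  qed
  have form: "inner (T x) x = r * (norm (p x))\<^sup>2" for x
  proof (rule antisym)
    have L: "(\<lambda>n. (r + inverse (real (Suc n))) * (norm (p x))\<^sup>2) \<longlonglongrightarrow> (r + 0) * (norm (p x))\<^sup>2"
      and R: "(\<lambda>n. (r - inverse (real (Suc n))) * (norm (p x))\<^sup>2) \<longlonglongrightarrow> (r - 0) * (norm (p x))\<^sup>2"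
      by (intro tendsto_intros LIMSEQ_inverse_real_of_nat)+
    show "inner (T x) x \<le> r * (norm (p x))\<^sup>2"
      using LIMSEQ_le_const[OF L, of "inner (T x) x"] up[of "r + inverse (real (Suc _))" x] by simp
    show "r * (norm (p x))\<^sup>2 \<le> inner (T x) x"
      using LIMSEQ_le_const2[OF R, of "inner (T x) x"] low[of "r - inverse (real (Suc _))" x] by simp
  qed
  have "T - r *\<^sub>R p = 0"
  proof (rule selfadjoint_zero_form)
    show "selfadjoint (T - r *\<^sub>R p)"
      using pp(2) by (intro selfadjoint_diff selfadjoint_scaleR T) (simp add: projection_def)
    show "inner ((T - r *\<^sub>R p) x) x = 0" for x
      by (simp add: blinfun.diff_left blinfun.scaleR_left inner_diff_left form projection_inner_self[OF pp(2)])
  qed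
  then show ?thesis by (intro that[of r]) simp
qed

text \<open>Split \<open>S = p T p\<close> into its real part \<open>(S + S\<^sup>*) / 2\<close> and its imaginary part
\<open>- \<i> (S - S\<^sup>*) / 2\<close>.\<close>

lemma minimal_corner_scalar:
  assumes p: "minimal p" and T: "T \<in> M"
  obtains c where "p o\<^sub>L T o\<^sub>L p = c *\<^sub>C p"
proof -
  have pp: "p \<in> M" "projection p" using p by (auto simp: minimal_def)
  define S where "S = p o\<^sub>L T o\<^sub>L p"
  define R where "R = adj S"
  have SM: "S \<in> M" unfolding S_def by (intro mem_compose pp T)
  have RM: "R \<in> M" unfolding R_def by (intro mem_adj SM)
  have SR: "inner (S x) y = inner x (R y)" and RS: "inner (R x) y = inner x (S y)" for x y
    using inner_adj_M[OF SM] inner_adj_M[OF RM] by (simp_all add: R_def adj_adj_M[OF SM])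
  have pS: "p (S x) = S x" and Sp: "S (p x) = S x" for x
    by (simp_all add: S_def projection_idem[OF pp(2)])
  have pR: "p (R x) = R x" for x
  proof (rule inner_eq_all_imp_eq)
    fix y show "inner y (p (R x)) = inner y (R x)"
      by (simp add: Sp flip: projection_inner[OF pp(2)] SR)
  qed
  have "p o\<^sub>L (S + R) = S + R"
    by (rule blinfun_eqI) (simp add: blinfun.add_left blinfun.add_right pS pR)
  moreover have "selfadjoint (S + R)"
    by (simp add: selfadjoint_def blinfun.add_left inner_add_left inner_add_right SR RS)
  ultimately obtain a where a: "S + R = a *\<^sub>R p"
    using minimal_selfadjoint_scalar[OF p mem_add[OF SM RM]] by metis
  have "p o\<^sub>L (\<i> *\<^sub>C (S - R)) = \<i> *\<^sub>C (S - R)"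
    by (rule blinfun_eqI)
      (simp add: blinfun_apply_scaleC blinfun.diff_left blinfun.diff_right pS pR
        bounded_operatorsD[OF mem_bounded_operators[OF pp(1)]])
  moreover have "selfadjoint (\<i> *\<^sub>C (S - R))"
    unfolding selfadjoint_def
  proof (intro allI)
    fix x y
    have "S (\<i> *\<^sub>C y) = \<i> *\<^sub>C S y" "R (\<i> *\<^sub>C y) = \<i> *\<^sub>C R y"
      using bounded_operatorsD mem_bounded_operators SM RM by blast+
    moreover have "inner (\<i> *\<^sub>C (S - R) x) y = - inner ((S - R) x) (\<i> *\<^sub>C y)"
      by (simp add: inner_scaleC_adjoint complex_vector.scale_minus_left)
    ultimately show "inner ((\<i> *\<^sub>C (S - R)) x) y = inner x ((\<i> *\<^sub>C (S - R)) y)"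
      by (simp add: blinfun_apply_scaleC blinfun.diff_left inner_diff_left inner_diff_right SR RS
        complex_vector.scale_right_diff_distrib)
  qed
  ultimately obtain b where b: "\<i> *\<^sub>C (S - R) = b *\<^sub>R p"
    using minimal_selfadjoint_scalar[OF p mem_scaleC[OF mem_diff[OF SM RM]]] by metis
  have "2 *\<^sub>C S = (S + R) + (- \<i>) *\<^sub>C (\<i> *\<^sub>C (S - R))"
    using scaleR_2[of S] by (simp add: scaleC_scaleC scaleC_one scaleR_scaleC)
  also have "\<dots> = (complex_of_real a - \<i> * complex_of_real b) *\<^sub>C p"
    unfolding a b
    by (simp add: scaleR_scaleC scaleC_scaleC complex_vector.scale_left_diff_distrib
      complex_vector.scale_minus_left)
  finally have "(1/2) *\<^sub>C (2 *\<^sub>C S) = (1/2) *\<^sub>C ((complex_of_real a - \<i> * complex_of_real b) *\<^sub>C p)"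
    by simp
  then have "S = ((1/2) * (complex_of_real a - \<i> * complex_of_real b)) *\<^sub>C p"
    by (simp only: scaleC_scaleC) (simp add: scaleC_one)
  then show ?thesis unfolding S_def by (rule that)
qed

text \<open>If some \<open>v = p T\<^sub>0 q\<close> is nonzero, then \<open>v v\<^sup>* = \<mu> p\<close> with \<open>\<mu> \<noteq> 0\<close>, and \<open>v\<^sup>* T q = c q\<close> for each \<open>T\<close>. Hence
\<open>\<mu> p T q = v v\<^sup>* T q = c v\<close>.\<close>

lemma minimal_off_corner:
  assumes p: "minimal p" and q: "minimal q"
  shows "\<exists>v\<in>M. \<forall>T\<in>M. \<exists>c. p o\<^sub>L T o\<^sub>L q = c *\<^sub>C v"
proof (cases "\<forall>T\<in>M. p o\<^sub>L T o\<^sub>L q = 0")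
  case True
  then show ?thesis using mem_0 by (intro bexI[of _ 0]) auto
next
  case False
  then obtain T0 where T0: "T0 \<in> M" "p o\<^sub>L T0 o\<^sub>L q \<noteq> 0" by blast
  have pp: "p \<in> M" "projection p" and qq: "q \<in> M" "projection q" using p q by (auto simp: minimal_def)
  define v where "v = p o\<^sub>L T0 o\<^sub>L q"
  have vM: "v \<in> M" unfolding v_def by (intro mem_compose pp qq T0)
  have pv: "p (v x) = v x" and vq: "v (q x) = v x" for x
    by (simp_all add: v_def projection_idem[OF pp(2)] projection_idem[OF qq(2)])
  have qv: "q (adj v x) = adj v x" for x
  proof (rule inner_eq_all_imp_eq)
    fix y show "inner y (q (adj v x)) = inner y (adj v x)"
      by (simp add: vq flip: projection_inner[OF qq(2)] inner_adj_M[OF vM])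
  qed
  have vp: "adj v (p x) = adj v x" for x
  proof (rule inner_eq_all_imp_eq)
    fix y show "inner y (adj v (p x)) = inner y (adj v x)"
      by (simp add: pv flip: inner_adj_M[OF vM] projection_inner[OF pp(2)])
  qed
  have v0: "v o\<^sub>L adj v \<noteq> 0"
  proof
    assume "v o\<^sub>L adj v = 0"
    then have "adj v x = 0" for x using times_adj_kernel[OF vM, of x] by simp
    then have "inner (v x) (v x) = 0" for x by (simp add: inner_adj_M[OF vM])
    then have "v = 0" by (intro blinfun_eqI) simp
    then show False using T0(2) by (simp add: v_def)
  qed
  obtain \<mu> where "p o\<^sub>L (v o\<^sub>L adj v) o\<^sub>L p = \<mu> *\<^sub>C p"
    using minimal_corner_scalar[OF p mem_compose[OF vM mem_adj[OF vM]]] by metis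
  then have "blinfun_apply (p o\<^sub>L (v o\<^sub>L adj v) o\<^sub>L p) x = blinfun_apply (\<mu> *\<^sub>C p) x" for x by simp
  then have \<mu>: "v (adj v x) = \<mu> *\<^sub>C p x" for x
    by (simp add: pv vp blinfun_apply_scaleC)
  have "\<mu> \<noteq> 0"
  proof
    assume "\<mu> = 0"
    then have "v o\<^sub>L adj v = 0" by (intro blinfun_eqI) (simp add: \<mu>)
    then show False using v0 by simp
  qed
  have "\<exists>c. p o\<^sub>L T o\<^sub>L q = c *\<^sub>C v" if T: "T \<in> M" for T
  proof -
    obtain c where "q o\<^sub>L (adj v o\<^sub>L T) o\<^sub>L q = c *\<^sub>C q"
      using minimal_corner_scalar[OF q mem_compose[OF mem_adj[OF vM] T]] by metis
    then have "blinfun_apply (q o\<^sub>L (adj v o\<^sub>L T) o\<^sub>L q) x = blinfun_apply (c *\<^sub>C q) x" for x by simp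
    then have c: "adj v (T (q x)) = c *\<^sub>C q x" for x
      by (simp add: qv blinfun_apply_scaleC)
    have "p (T (q x)) = (c / \<mu>) *\<^sub>C v x" for x
    proof -
      have "\<mu> *\<^sub>C p (T (q x)) = v (c *\<^sub>C q x)" by (simp add: c flip: \<mu>)
      also have "\<dots> = c *\<^sub>C v x"
        by (simp add: bounded_operatorsD[OF mem_bounded_operators[OF vM]] vq)
      finally have "inverse \<mu> *\<^sub>C \<mu> *\<^sub>C p (T (q x)) = inverse \<mu> *\<^sub>C c *\<^sub>C v x" by simp
      then show ?thesis using \<open>\<mu> \<noteq> 0\<close> by (simp add: scaleC_scaleC scaleC_one field_simps)
    qed
    then show ?thesis by (intro exI[of _ "c / \<mu>"] blinfun_eqI) (simp add: blinfun_apply_scaleC)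
  qed
  then show ?thesis using vM by blast
qed

section \<open>Projections increasing to the unit\<close>

text \<open>Well-founded induction on \<open>p\<close>: a \<open>p\<close> that is neither \<open>0\<close> nor minimal is the sum of two projections
\<open>q\<close> and \<open>p - q\<close> strictly below it.\<close>

lemma sum_of_minimal:
  assumes wf: "wf {(q, p). q \<in> M \<and> projection q \<and> p o\<^sub>L q = q \<and> q \<noteq> p}"
    and p: "p \<in> M" "projection p"
  shows "\<exists>ps. (\<forall>q\<in>set ps. minimal q) \<and> p = sum_list ps"
  using p
proof (induction p rule: wf_induct_rule[OF wf])
  case (1 p)
  consider "p = 0" | "minimal p" | q where "q \<in> M" "projection q" "p o\<^sub>L q = q" "q \<noteq> 0" "q \<noteq> p"
    using 1(2,3) by (auto simp: minimal_def)
  then show ?case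
  proof cases
    case 1
    then show ?thesis by (intro exI[of _ "[]"]) simp
  next
    case 2
    then show ?thesis by (intro exI[of _ "[p]"]) simp
  next
    case (3 q)
    have pq: "p (q x) = q x" and qp: "q (p x) = q x" for x
      using compose_eqD[OF 3(3)] compose_eqD[OF iffD1[OF projection_absorb_commute[OF 1(3) 3(2)] 3(3)]]
      by auto
    have d: "p - q \<in> M" "projection (p - q)" "p o\<^sub>L (p - q) = p - q" "p - q \<noteq> p"
    proof -
      show "p - q \<in> M" by (intro mem_diff 1(2) 3(1))
      have "selfadjoint (p - q)"
        using 1(3) 3(2) by (intro selfadjoint_diff) (simp_all add: projection_def)
      moreover have "(p - q) o\<^sub>L (p - q) = p - q"
        by (rule blinfun_eqI)
          (simp add: blinfun.diff_left blinfun.diff_right pq qp projection_idem[OF 1(3)] projection_idem[OF 3(2)])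
      ultimately show "projection (p - q)" by (simp add: projection_def)
      show "p o\<^sub>L (p - q) = p - q"
        by (rule blinfun_eqI) (simp add: blinfun.diff_left blinfun.diff_right pq projection_idem[OF 1(3)])
      show "p - q \<noteq> p" using 3(4) by simp
    qed
    obtain qs where qs: "\<forall>r\<in>set qs. minimal r" "q = sum_list qs"
      using 1(1)[of q] 3 by auto
    obtain rs where rs: "\<forall>r\<in>set rs. minimal r" "p - q = sum_list rs"
      using 1(1)[of "p - q"] d by auto
    have "p = sum_list (qs @ rs)" by (simp flip: qs(2) rs(2))
    then show ?thesis using qs(1) rs(1) by (intro exI[of _ "qs @ rs"]) auto
  qed
qed

lemma sum_list_compose_left:
  assumes "csubspace V" "\<And>p. p \<in> set ps \<Longrightarrow> p o\<^sub>L X \<in> V"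
  shows "sum_list ps o\<^sub>L X \<in> V"
  using assms(2)
  by (induction ps)
    (auto simp: bounded_bilinear.add_left[OF bounded_bilinear_blinfun_compose]
      intro: complex_vector.subspace_0[OF assms(1)] complex_vector.subspace_add[OF assms(1)])

lemma sum_list_compose_right:
  assumes "csubspace V" "\<And>p. p \<in> set ps \<Longrightarrow> X o\<^sub>L p \<in> V"
  shows "X o\<^sub>L sum_list ps \<in> V"
  using assms(2)
  by (induction ps)
    (auto simp: bounded_bilinear.add_right[OF bounded_bilinear_blinfun_compose]
      intro: complex_vector.subspace_0[OF assms(1)] complex_vector.subspace_add[OF assms(1)])

lemma finite_dimensional_if_sum_of_minimal:
  assumes e: "is_unit_of M e" and ps: "\<forall>p\<in>set ps. minimal p" "e = sum_list ps"
  shows "\<not> infinite_dimensional M"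
proof -
  have "\<exists>v. v \<in> M \<and> (\<forall>T\<in>M. \<exists>c. p o\<^sub>L T o\<^sub>L q = c *\<^sub>C v)" if "minimal p" "minimal q" for p q
    using minimal_off_corner[OF that] by blast
  then obtain v where v: "\<And>p q. minimal p \<Longrightarrow> minimal q \<Longrightarrow> v p q \<in> M"
    "\<And>p q T. minimal p \<Longrightarrow> minimal q \<Longrightarrow> T \<in> M \<Longrightarrow> \<exists>c. p o\<^sub>L T o\<^sub>L q = c *\<^sub>C v p q"
    by metis
  define B where "B = (\<lambda>(p, q). v p q) ` (set ps \<times> set ps)"
  have fin: "finite B" by (simp add: B_def)
  have BM: "B \<subseteq> M" using v(1) ps(1) by (auto simp: B_def)
  have span: "csubspace (cspan B)" by (rule complex_vector.subspace_span)
  have "cspan B = M"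
  proof
    show "cspan B \<subseteq> M" by (rule complex_vector.span_minimal[OF BM subspace_M])
    show "M \<subseteq> cspan B"
    proof
      fix T assume T: "T \<in> M"
      have "e o\<^sub>L T o\<^sub>L e \<in> cspan B"
        unfolding ps(2)
      proof (rule sum_list_compose_right[OF span])
        fix q assume q: "q \<in> set ps"
        have "sum_list ps o\<^sub>L (T o\<^sub>L q) \<in> cspan B"
        proof (rule sum_list_compose_left[OF span])
          fix p assume p: "p \<in> set ps"
          obtain c where "p o\<^sub>L T o\<^sub>L q = c *\<^sub>C v p q" using v(2)[of p q T] p q ps(1) T by blast
          then have "p o\<^sub>L (T o\<^sub>L q) = c *\<^sub>C v p q" by (metis blinfun_eqI blinfun_apply_blinfun_compose)
          moreover have "v p q \<in> cspan B"
            using p q by (intro complex_vector.span_base) (auto simp: B_def)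
          ultimately show "p o\<^sub>L (T o\<^sub>L q) \<in> cspan B"
            using complex_vector.subspace_scale[OF span] by simp
        qed
        moreover have "sum_list ps o\<^sub>L (T o\<^sub>L q) = sum_list ps o\<^sub>L T o\<^sub>L q"
          by (rule blinfun_eqI) simp
        ultimately show "sum_list ps o\<^sub>L T o\<^sub>L q \<in> cspan B" by simp
      qed
      then show "T \<in> cspan B" using e T by (simp add: is_unit_of_def)
    qed
  qed
  then show ?thesis using fin BM by (auto simp: infinite_dimensional_def)
qed

lemma decreasing_projections:
  assumes inf: "infinite_dimensional M"
  obtains F :: "nat \<Rightarrow> 'h \<Rightarrow>\<^sub>L 'h"
  where "\<And>n. F n \<in> M" "\<And>n. projection (F n)" "\<And>n. F n o\<^sub>L F (Suc n) = F (Suc n)"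
    "\<And>n. F (Suc n) \<noteq> F n"
proof -
  let ?r = "{(q, p). q \<in> M \<and> projection q \<and> p o\<^sub>L q = q \<and> q \<noteq> p}"
  obtain e where e: "is_unit_of M e" "projection e" using unit_exists by blast
  have "\<not> wf ?r"
  proof
    assume "wf ?r"
    then obtain ps where "\<forall>q\<in>set ps. minimal q" "e = sum_list ps"
      using sum_of_minimal[OF _ _ e(2)] e(1) by (auto simp: is_unit_of_def)
    then show False using finite_dimensional_if_sum_of_minimal[OF e(1)] inf by blast
  qed
  then obtain f where f: "\<And>n. (f (Suc n), f n) \<in> ?r"
    unfolding wf_iff_no_infinite_down_chain by blast
  show ?thesis
    by (rule that[of "\<lambda>n. f (Suc n)"]) (use f in auto)
qed

text \<open>The projections \<open>g n = e - F n\<close> increase strictly, but only to some \<open>E \<le> e\<close>. Adding the constant \<open>e - E\<close>,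
which is orthogonal to all of them, moves the supremum to \<open>e\<close>.\<close>

lemma increasing_projections_to_unit:
  assumes inf: "infinite_dimensional M" and e: "is_unit_of M e" "projection e"
  obtains P :: "nat \<Rightarrow> 'h \<Rightarrow>\<^sub>L 'h"
  where "\<And>n. P n \<in> M" "\<And>n. projection (P n)" "\<And>n. P n \<noteq> e"
    "\<And>n. P (Suc n) o\<^sub>L P n = P n"
    "\<And>u. u \<in> M \<Longrightarrow> (\<And>n. P n o\<^sub>L u = P n) \<Longrightarrow> u = e"
proof -
  obtain F :: "nat \<Rightarrow> 'h \<Rightarrow>\<^sub>L 'h" where F: "\<And>n. F n \<in> M" "\<And>n. projection (F n)"
    "\<And>n. F n o\<^sub>L F (Suc n) = F (Suc n)" "\<And>n. F (Suc n) \<noteq> F n"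
    using decreasing_projections[OF inf] by blast
  have eM: "e \<in> M" using e(1) by (simp add: is_unit_of_def)
  have eT: "e (T x) = T x" and Te: "T (e x) = T x" if "T \<in> M" for T x
    using e(1) that compose_eqD[of e T T x] compose_eqD[of T e T x] by (auto simp: is_unit_of_def)
  have FF: "F n (F (Suc n) x) = F (Suc n) x" and FF': "F (Suc n) (F n x) = F (Suc n) x" for n x
    using compose_eqD[OF F(3)] compose_eqD[OF iffD1[OF projection_absorb_commute[OF F(2) F(2)] F(3)]]
    by auto
  define g where "g n = e - F n" for n
  have gx: "g n x = e x - F n x" for n x by (simp add: g_def blinfun.diff_left)
  have diff_proj: "projection (e - p)" if "p \<in> M" "projection p" for p
  proof -
    have "selfadjoint (e - p)"
      using e(2) that(2) by (intro selfadjoint_diff) (simp_all add: projection_def)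
    moreover have "(e - p) o\<^sub>L (e - p) = e - p"
      by (rule blinfun_eqI)
        (simp add: blinfun.diff_left blinfun.diff_right eT[OF that(1)] Te[OF that(1)]
          projection_idem[OF e(2)] projection_idem[OF that(2)])
    ultimately show ?thesis by (simp add: projection_def)
  qed
  have gM: "g n \<in> M" and gp: "projection (g n)" for n
    unfolding g_def by (auto intro: mem_diff eM F diff_proj)
  have gS: "g (Suc n) (g n x) = g n x" for n x
    by (simp add: gx blinfun.diff_right eT[OF F(1)] Te[OF F(1)] FF' projection_idem[OF e(2)])
  have gmono: "g m (g n x) = g n x" if "n \<le> m" for m n x
    using that
  proof (induction m rule: dec_induct)
    case base
    show ?case by (simp add: projection_idem[OF gp])
  next
    case (step m)
    then show ?case using gS[of m "g n x"] by simp
  qed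
  have dir: "\<exists>r\<in>range g. r o\<^sub>L p = p \<and> r o\<^sub>L q = q" if "p \<in> range g" "q \<in> range g" for p q
  proof -
    from that obtain m n where "p = g m" "q = g n" by blast
    then show ?thesis
      by (intro bexI[of _ "g (max m n)"]) (auto intro!: blinfun_eqI simp: gmono)
  qed
  have "range g \<subseteq> M" "range g \<noteq> {}" "\<And>p. p \<in> range g \<Longrightarrow> projection p"
    using gM gp by auto
  from sup_projection[OF this dir]
  have "\<exists>E\<in>M. projection E \<and> (\<forall>p\<in>range g. E o\<^sub>L p = p)
      \<and> (\<forall>x. (\<forall>p\<in>range g. p x = 0) \<longrightarrow> E x = 0)"
    by metis
  then obtain E where E: "E \<in> M" "projection E" "\<And>n. E o\<^sub>L g n = g n"
    "\<And>x. (\<And>n. g n x = 0) \<Longrightarrow> E x = 0" by blast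
  have Eg: "E (g n x) = g n x" and gE: "g n (E x) = g n x" for n x
    using compose_eqD[OF E(3)] compose_eqD[OF iffD1[OF projection_absorb_commute[OF E(2) gp] E(3)]]
    by auto
  define P where "P n = (e - E) + g n" for n
  have Px: "P n x = e x - E x + g n x" for n x by (simp add: P_def blinfun.add_left blinfun.diff_left)
  have PM: "P n \<in> M" for n unfolding P_def by (intro mem_add mem_diff eM E gM)
  have PS: "P (Suc n) (P n x) = P n x" and PP: "P n (P n x) = P n x" for n x
    by (simp_all add: Px blinfun.diff_right blinfun.add_right projection_idem[OF e(2)] eT[OF E(1)]
      Te[OF E(1)] projection_idem[OF E(2)] eT[OF gM] Te[OF gM] Eg gE gS projection_idem[OF gp])
  show ?thesis
  proof (rule that[of P])
    show "P n \<in> M" for n by (rule PM)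
    show "projection (P n)" for n
      unfolding projection_def
    proof
      show "selfadjoint (P n)"
        unfolding P_def using e(2) E(2) gp[of n]
        by (intro selfadjoint_add selfadjoint_diff) (simp_all add: projection_def)
      show "P n o\<^sub>L P n = P n" by (rule blinfun_eqI) (simp add: PP)
    qed
    show "P (Suc n) o\<^sub>L P n = P n" for n by (rule blinfun_eqI) (simp add: PS)
    show "P n \<noteq> e" for n
    proof
      assume "P n = e"
      then have "E = g n" by (simp add: P_def)
      \<comment> \<open>then \<open>g n\<close> is the supremum, so \<open>g (n + 1) = g n\<close>, against strict increase\<close>
      then have "g n (g (Suc n) x) = g (Suc n) x" for x using Eg by metis
      then have "g n = g (Suc n)"
        using compose_eqD
          iffD1[OF projection_absorb_commute[OF gp[of n] gp[of "Suc n"]]] gS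
        by (metis blinfun_eqI blinfun_apply_blinfun_compose)
      then show False using F(4)[of n] by (simp add: g_def)
    qed
    show "u = e" if u: "u \<in> M" and Pu: "\<And>n. P n o\<^sub>L u = P n" for u
    proof (rule blinfun_eqI)
      fix x
      \<comment> \<open>every \<open>P n\<close> annihilates \<open>u - e\<close>, hence so do the \<open>g n\<close> below them and the supremum \<open>E\<close>
        of the \<open>g n\<close>, and likewise \<open>e - E\<close>, which lies below \<open>P 0\<close>\<close>
      have gP: "g n (P n y) = g n y" for n y
        by (simp add: Px blinfun.diff_right blinfun.add_right Te[OF gM] gE projection_idem[OF gp])
      have "g n (u x - e x) = 0" for n
        using gP[of n "u x"] gP[of n x] compose_eqD[OF Pu, of n x]
        by (simp add: blinfun.diff_right Te[OF gM])
      then have "E (u x - e x) = 0" by (rule E(4))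
      then have 1: "E (u x) = E x" by (simp add: blinfun.diff_right Te[OF E(1)])
      have "e (P 0 y) - E (P 0 y) = e y - E y" for y
        by (simp add: Px blinfun.diff_right blinfun.add_right projection_idem[OF e(2)] eT[OF E(1)]
          Te[OF E(1)] projection_idem[OF E(2)] eT[OF gM] Eg)
      from this[of "u x"] this[of x] have "e (u x) - E (u x) = e x - E x"
        using compose_eqD[OF Pu, of 0 x] by simp
      then show "u x = e x" using 1 eT[OF u] by simp
    qed
  qed
qed

section \<open>The star order\<close>

text \<open>Moving from \<open>z\<close> to \<open>x\<close> step by step gives \<open>x x\<^sup>* z = x y\<^sup>* z = x y\<^sup>* y = x x\<^sup>* y = x x\<^sup>* x\<close>, and the
leading \<open>x\<close> can be cancelled as \<open>x\<close> is injective on the range of \<open>x\<^sup>*\<close>.\<close>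

lemma star_trans_left:
  assumes M: "x \<in> M" "y \<in> M" "z \<in> M"
    and xy: "adj x o\<^sub>L x = adj x o\<^sub>L y" "x o\<^sub>L adj x = x o\<^sub>L adj y"
    and yz: "adj y o\<^sub>L y = adj y o\<^sub>L z"
  shows "adj x o\<^sub>L x = adj x o\<^sub>L z"
proof (rule blinfun_eqI)
  fix w
  have "x (adj x (z w)) = x (adj y (z w))" using compose_eqD[OF xy(2), of "z w"] by simp
  also have "\<dots> = x (adj y (y w))" using compose_eqD[OF yz, of w] by simp
  also have "\<dots> = x (adj x (y w))" using compose_eqD[OF xy(2), of "y w"] by simp
  also have "\<dots> = x (adj x (x w))" using compose_eqD[OF xy(1), of w] by simp
  finally have "(x o\<^sub>L adj x) (x w - z w) = 0" by (simp add: blinfun.diff_right)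
  then have "adj x (x w - z w) = 0" using times_adj_kernel[OF M(1)] by blast
  then show "(adj x o\<^sub>L x) w = (adj x o\<^sub>L z) w" by (simp add: blinfun.diff_right)
qed

lemma star_le_adj:
  assumes "x \<in> M" "y \<in> M" "star_le x y"
  shows "x o\<^sub>L adj x = x o\<^sub>L adj y" "adj x o\<^sub>L x = adj y o\<^sub>L x"
proof -
  have "adj (x o\<^sub>L adj x) = adj (y o\<^sub>L adj x)" "adj (adj x o\<^sub>L x) = adj (adj x o\<^sub>L y)"
    using assms(3) by (simp_all add: star_le_def)
  then show "x o\<^sub>L adj x = x o\<^sub>L adj y" "adj x o\<^sub>L x = adj y o\<^sub>L x"
    using assms(1,2) by (simp_all add: adj_compose_M mem_adj adj_adj_M)
qed

lemma star_le_refl: "star_le x x"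
  by (simp add: star_le_def)

text \<open>The adjoint operation preserves the star order and exchanges its two defining equations, so the
one-sided result is applied to \<open>x, y, z\<close> and to their adjoints.\<close>

lemma star_le_trans:
  assumes M: "x \<in> M" "y \<in> M" "z \<in> M" and xy: "star_le x y" and yz: "star_le y z"
  shows "star_le x z"
proof -
  have 1: "adj x o\<^sub>L x = adj x o\<^sub>L z"
    using star_trans_left[OF M] star_le_adj[OF M(1,2) xy] xy yz by (simp add: star_le_def)
  have "adj (adj x) o\<^sub>L adj x = adj (adj x) o\<^sub>L adj z"
  proof (rule star_trans_left[of "adj x" "adj y" "adj z"])
    show "adj (adj x) o\<^sub>L adj x = adj (adj x) o\<^sub>L adj y"
      using star_le_adj[OF M(1,2) xy] by (simp add: adj_adj_M M)
    show "adj x o\<^sub>L adj (adj x) = adj x o\<^sub>L adj (adj y)"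
      using xy by (simp add: adj_adj_M M star_le_def)
    show "adj (adj y) o\<^sub>L adj y = adj (adj y) o\<^sub>L adj z"
      using star_le_adj[OF M(2,3) yz] by (simp add: adj_adj_M M)
  qed (intro mem_adj M)+
  then have "adj (x o\<^sub>L adj x) = adj (x o\<^sub>L adj z)" by (simp add: adj_adj_M M)
  then have "x o\<^sub>L adj x = z o\<^sub>L adj x"
    by (simp add: adj_compose_M adj_adj_M M mem_adj)
  with 1 show ?thesis by (simp add: star_le_def)
qed

lemma star_le_projections:
  assumes "p \<in> M" "projection p" "projection q" "q o\<^sub>L p = p"
  shows "star_le p q"
proof -
  have "adj p = p" by (rule adj_selfadjoint_M) (use assms in \<open>auto simp: projection_def\<close>)
  moreover have "p o\<^sub>L q = p" using projection_absorb_commute[OF assms(3,2)] assms(4) by simp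
  ultimately show ?thesis using assms(2,4) by (simp add: star_le_def projection_def)
qed

lemma unit_unique: "is_unit_of M e \<Longrightarrow> is_unit_of M f \<Longrightarrow> f = e"
  by (metis is_unit_of_def)

lemma proper_projection_not_invertible:
  assumes e: "is_unit_of M e" and p: "p \<in> M" "projection p" "p \<noteq> e"
  shows "p \<notin> invertibles M"
proof
  assume "p \<in> invertibles M"
  then obtain f y where f: "is_unit_of M f" "y \<in> M" "p o\<^sub>L y = f" by (auto simp: invertibles_def)
  then have py: "p o\<^sub>L y = e" using unit_unique[OF e] by simp
  have "p o\<^sub>L e = e"
    by (rule blinfun_eqI) (simp add: projection_idem[OF p(2)] flip: py)
  then show False using e p(1,3) by (simp add: is_unit_of_def)
qed

lemma unit_invertible: "is_unit_of M e \<Longrightarrow> e \<in> invertibles M"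
  by (auto simp: invertibles_def is_unit_of_def)

text \<open>Because \<open>e - p\<close> is a nonzero projection, it fixes some nonzero vector.\<close>

lemma norm_unit_minus_projection:
  assumes e: "is_unit_of M e" "projection e" and p: "p \<in> M" "projection p" "p \<noteq> e"
  shows "norm (p - e) \<ge> 1"
proof -
  obtain w where w: "p w \<noteq> e w" using p(3) blinfun_eqI by blast
  define u where "u = p w - e w"
  have "e (p x) = p x" "p (e x) = p x" for x
    using e(1) p(1) compose_eqD[of e p p x] compose_eqD[of p e p x] by (auto simp: is_unit_of_def)
  then have "(p - e) u = - u"
    by (simp add: u_def blinfun.diff_left blinfun.diff_right projection_idem[OF p(2)] projection_idem[OF e(2)])
  then have "norm u \<le> norm (p - e) * norm u" using norm_blinfun[of "p - e" u] by simp
  then show ?thesis using w by (simp add: u_def)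
qed

text \<open>The sequence \<open>P\<close> is enclosed between itself and the constant sequence \<open>e\<close>. An upper bound \<open>u\<close> of the
sequence satisfies \<open>P n u = P n\<close> for all \<open>n\<close>, so \<open>e\<close> is the only one.\<close>

lemma not_order_closed_if_no_unit:
  assumes e: "is_unit_of M e" "projection e" and C: "C \<subseteq> M" "e \<notin> C"
    and P: "\<And>n. P n \<in> C" "\<And>n :: nat. projection (P n)" "\<And>n. P (Suc n) o\<^sub>L P n = P n"
    and upper: "\<And>u. u \<in> M \<Longrightarrow> (\<And>n. P n o\<^sub>L u = P n) \<Longrightarrow> u = e"
  shows "\<not> order_closed M star_le C"
proof
  assume closed: "order_closed M star_le C"
  have eM: "e \<in> M" using e(1) by (simp add: is_unit_of_def)
  have PM: "P n \<in> M" for n using P(1) C(1) by blast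
  have Pe: "star_le (P n) e" for n
    by (rule star_le_projections[OF PM P(2) e(2)]) (use e(1) PM in \<open>simp add: is_unit_of_def\<close>)
  have mono: "star_le (P m) (P n)" if "m \<le> n" for m n
    using that
  proof (induction n rule: dec_induct)
    case base
    show ?case by (rule star_le_refl)
  next
    case (step n)
    then show ?case
      using star_le_trans[OF PM PM PM] star_le_projections[OF PM P(2) P(2) P(3)] by blast
  qed
  have sup: "is_supremum M star_le (range P) e"
    unfolding is_supremum_def
  proof (intro conjI ballI impI)
    show "star_le a e" if "a \<in> range P" for a using that Pe by blast
    show "star_le e u" if u: "u \<in> M" "\<forall>a\<in>range P. star_le a u" for u
    proof -
      have "P n o\<^sub>L u = P n" for n
      proof -
        have "adj (P n) = P n"
          by (rule adj_selfadjoint_M[OF PM]) (use P(2) in \<open>simp add: projection_def\<close>)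
        moreover have "star_le (P n) u" using u(2) by blast
        ultimately show ?thesis using P(2)[of n] by (simp add: star_le_def projection_def)
      qed
      then have "u = e" by (rule upper[OF u(1)])
      then show ?thesis by (simp add: star_le_refl)
    qed
  qed (rule eM)
  have conv: "order_convergent M star_le (UNIV :: nat set) (\<le>) P e"
    unfolding order_convergent_def
  proof (intro exI conjI ballI impI)
    show "is_supremum M star_le (range P) e" by (rule sup)
    show "is_infimum M star_le (range (\<lambda>_ :: nat. e)) e"
      by (simp add: is_infimum_def eM star_le_refl)
  qed (use PM Pe eM mono in \<open>auto simp: star_le_refl\<close>)
  have dir: "directed_index (UNIV :: nat set) (\<le>)"
    unfolding directed_index_def by (metis UNIV_I UNIV_not_empty le_cases order_refl order_trans)
  have img: "range P \<subseteq> C" using P(1) by blast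
  have "e \<in> C"
    by (rule order_closedD[OF _ _ closed dir img conv]) (rule star_le_trans star_le_refl; assumption)+
  then show False using C(2) by simp
qed

lemma scaled_unit_maximal:
  assumes e: "is_unit_of M e" "projection e" and t: "t \<noteq> 0" and z: "z \<in> M" "star_le (t *\<^sub>R e) z"
  shows "z = t *\<^sub>R e"
proof -
  have eM: "e \<in> M" using e(1) by (simp add: is_unit_of_def)
  have "adj (t *\<^sub>R e) = t *\<^sub>R e"
    using e(2) by (intro adj_selfadjoint_M mem_scaleR eM selfadjoint_scaleR) (simp add: projection_def)
  then have "(t *\<^sub>R e) o\<^sub>L (t *\<^sub>R e) = (t *\<^sub>R e) o\<^sub>L z" using z(2) by (simp add: star_le_def)
  moreover have "(t *\<^sub>R e) o\<^sub>L T = t *\<^sub>R T" if "T \<in> M" for T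
  proof (rule blinfun_eqI)
    have "e o\<^sub>L T = T" using e(1) that by (simp add: is_unit_of_def)
    then show "((t *\<^sub>R e) o\<^sub>L T) x = (t *\<^sub>R T) x" for x
      by (simp add: blinfun.scaleR_left compose_eqD)
  qed
  ultimately have "t *\<^sub>R (t *\<^sub>R e) = t *\<^sub>R z" using mem_scaleR[OF eM] z(1) by simp
  then show ?thesis unfolding scaleR_cancel_left using t by simp
qed

text \<open>An upper enclosing net \<open>z\<close> lies above maximal elements of the star order, so \<open>z\<close> takes values in
the set. As \<open>z\<close> is decreasing, maximality makes it constant along the directed index set, and its
infimum is this constant value.\<close>

lemma order_closed_scaled_units:
  assumes e: "is_unit_of M e" "projection e" and t: "0 \<notin> t"
  shows "order_closed M star_le ((\<lambda>s. s *\<^sub>R e) ` t)"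
proof -
  let ?C = "(\<lambda>s. s *\<^sub>R e) ` t"
  have eM: "e \<in> M" using e(1) by (simp add: is_unit_of_def)
  have max: "b = a" if "a \<in> ?C" "b \<in> M" "star_le a b" for a b
  proof -
    obtain s where "a = s *\<^sub>R e" "s \<in> t" using \<open>a \<in> ?C\<close> by blast
    moreover have "s \<noteq> 0" using \<open>s \<in> t\<close> t by blast
    ultimately show ?thesis using scaled_unit_maximal[OF e] that by simp
  qed
  have CM: "?C \<subseteq> M" using mem_scaleR[OF eM] by blast
  have False if dir: "directed_index \<Gamma> r" and x: "x ` \<Gamma> \<subseteq> ?C" and l: "l \<in> M - ?C"
    and conv: "order_convergent M star_le \<Gamma> r x l"
    for \<Gamma> :: "(('h \<Rightarrow>\<^sub>L 'h) \<times> ('h \<Rightarrow>\<^sub>L 'h) \<times> ('h \<Rightarrow>\<^sub>L 'h)) set" and r x l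
  proof -
    from conv obtain y z where zM: "z ` \<Gamma> \<subseteq> M"
      and yxz: "\<forall>a\<in>\<Gamma>. star_le (y a) (x a) \<and> star_le (x a) (z a)"
      and dec: "\<forall>a\<in>\<Gamma>. \<forall>b\<in>\<Gamma>. r a b \<longrightarrow> star_le (z b) (z a)"
      and inf: "is_infimum M star_le (z ` \<Gamma>) l"
      unfolding order_convergent_def by (elim exE conjE)
    have zC: "z a \<in> ?C" if "a \<in> \<Gamma>" for a
    proof -
      have "z a = x a" by (rule max) (use that x zM yxz in auto)
      then show ?thesis using x that by auto
    qed
    have eq: "z a = z b" if "r b a" "a \<in> \<Gamma>" "b \<in> \<Gamma>" for a b
      using max[OF zC[OF that(2)], of "z b"] dec that zM by auto
    obtain a where a: "a \<in> \<Gamma>" using dir by (auto simp: directed_index_def)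
    have const: "z b = z a" if b: "b \<in> \<Gamma>" for b
    proof -
      obtain c where "c \<in> \<Gamma>" "r a c" "r b c" using dir a b unfolding directed_index_def by blast
      then show ?thesis using eq[of a c] eq[of b c] a b by simp
    qed
    have "z a \<in> M" using zM a by blast
    moreover have "\<forall>b\<in>z ` \<Gamma>. star_le (z a) b" using const star_le_refl by auto
    ultimately have "star_le (z a) l" using inf unfolding is_infimum_def by blast
    then have "l = z a" using max[OF zC[OF a]] l by blast
    then show False using zC[OF a] l by simp
  qed
  then show ?thesis using CM unfolding order_closed_def by blast
qed

end

theorem theorem4p9:
  fixes M :: "('h :: chilbert_space \<Rightarrow>\<^sub>L 'h) set"
  assumes "von_neumann_algebra M"
    and "infinite_dimensional M"
  shows "\<not> order_closed M star_le (M - invertibles M)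
    \<and> \<not> (\<forall>U. openin (order_topology M star_le) U \<longrightarrow> openin (norm_topology M) U)
    \<and> \<not> (\<forall>U. openin (norm_topology M) U \<longrightarrow> openin (order_topology M star_le) U)"
proof -
  interpret vn_algebra M by unfold_locales (rule assms(1))
  obtain e where e: "is_unit_of M e" "projection e" using unit_exists by blast
  have eM: "e \<in> M" using e(1) by (simp add: is_unit_of_def)
  obtain P :: "nat \<Rightarrow> 'h \<Rightarrow>\<^sub>L 'h" where P: "\<And>n. P n \<in> M" "\<And>n. projection (P n)" "\<And>n. P n \<noteq> e"
    "\<And>n. P (Suc n) o\<^sub>L P n = P n"
    "\<And>u. u \<in> M \<Longrightarrow> (\<And>n. P n o\<^sub>L u = P n) \<Longrightarrow> u = e"
    using increasing_projections_to_unit[OF assms(2) e] by metis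
  have "e \<noteq> 0"
  proof
    assume "e = 0"
    then have "P 0 = e" using e(1) P(1)[of 0] by (auto simp: is_unit_of_def)
    then show False using P(3) by blast
  qed
  have topology: "openin (order_topology M star_le) U \<longleftrightarrow> U \<subseteq> M \<and> order_closed M star_le (M - U)" for U
    by (rule openin_order_topology) (rule star_le_trans)
  have "\<not> order_closed M star_le (M - invertibles M)"
    by (rule not_order_closed_if_no_unit[where P = P, OF e _ _ _ P(2,4,5)])
      (use unit_invertible[OF e(1)] P(1) proper_projection_not_invertible[OF e(1) P(1,2,3)] in auto)
  moreover have "\<exists>U. openin (order_topology M star_le) U \<and> \<not> openin (norm_topology M) U"
  proof (intro exI conjI)
    let ?C = "(\<lambda>s. s *\<^sub>R e) ` range (\<lambda>n. inverse (real (Suc n)))"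
    have "?C \<subseteq> M" using mem_scaleR[OF eM] by blast
    moreover have "order_closed M star_le ?C" by (rule order_closed_scaled_units[OF e]) auto
    ultimately show "openin (order_topology M star_le) (M - ?C)"
      unfolding topology by (simp add: double_diff)
    show "\<not> openin (norm_topology M) (M - ?C)"
    proof
      assume "openin (norm_topology M) (M - ?C)"
      then obtain V where V: "open V" "M - ?C = M \<inter> V" by (auto simp: openin_open)
      have "0 \<in> V" using V(2) mem_0 \<open>e \<noteq> 0\<close> by auto
      moreover have "(\<lambda>n. inverse (real (Suc n)) *\<^sub>R e) \<longlonglongrightarrow> 0 *\<^sub>R e"
        by (intro tendsto_intros LIMSEQ_inverse_real_of_nat)
      ultimately have "\<forall>\<^sub>F n in sequentially. inverse (real (Suc n)) *\<^sub>R e \<in> V"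
        using V(1) by (auto dest: topological_tendstoD)
      then obtain n where "inverse (real (Suc n)) *\<^sub>R e \<in> V" by (auto simp: eventually_sequentially)
      moreover have "inverse (real (Suc n)) *\<^sub>R e \<in> M \<inter> ?C" using mem_scaleR[OF eM] by blast
      ultimately show False using V(2) by blast
    qed
  qed
  moreover have "\<exists>U. openin (norm_topology M) U \<and> \<not> openin (order_topology M star_le) U"
  proof (intro exI conjI)
    let ?U = "M \<inter> ball e 1"
    show "openin (norm_topology M) ?U" by (rule openin_open_Int) simp
    have "P n \<in> M - ?U" for n
      using norm_unit_minus_projection[OF e P(1-3)] P(1) by (simp add: dist_norm norm_minus_commute not_less)
    moreover have "e \<notin> M - ?U" using eM by simp
    ultimately have "\<not> order_closed M star_le (M - ?U)"
      by (intro not_order_closed_if_no_unit[where P = P, OF e _ _ _ P(2,4,5)]) auto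
    then show "\<not> openin (order_topology M star_le) ?U" unfolding topology by simp
  qed
  ultimately show ?thesis by blast
qed

end
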